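(* Let $n\ge 2$ be an integer, let $\mathcal{A}$ be a unital algebra over a commutative unital ring $\mathcal{R}$ with a nontrivial idempotent $e$, and put $f=1-e$. Suppose that $\mathcal{A}$ is $2$- and $(n-1)$-torsion free, and that for each $x\in\mathcal{A}$: $exe\cdot e\mathcal{A}f=\{0\}=f\mathcal{A}e\cdot exe$ implies $exe=0$, and $e\mathcal{A}f\cdot fxf=\{0\}=fxf\cdot f\mathcal{A}e$ implies $fxf=0$. Let $\varphi$ be a Lie $n$-derivation on $\mathcal{A}$. Suppose that one of the following statements holds: (i-1) $f\varphi(e\mathcal{A}e)f\subseteq f\mathcal{Z}(\mathcal{A})f$ and $e\varphi(f\mathcal{A}f)e\subseteq e\mathcal{Z}(\mathcal{A})e$; (i-2) $e\mathcal{A}e=\mathcal{S}(e\mathcal{A}e)$ and $f\mathcal{A}f=\mathcal{S}(f\mathcal{A}f)$; (i-3) $e\mathcal{A}e=\mathcal{S}(e\mathcal{A}e)$ and $\mathcal{Z}(e\mathcal{A}e)=e\mathcal{Z}(\mathcal{A})e$; (i-4) $f\mathcal{A}f=\mathcal{S}(f\mathcal{A}f)$ and $\mathcal{Z}(f\mathcal{A}f)=f\mathcal{Z}(\mathcal{A})f$; (i-5) $\mathcal{Z}(e\mathcal{A}e)=e\mathcal{Z}(\mathcal{A})e$ and $\mathcal{Z}(f\mathcal{A}f)=f\mathcal{Z}(\mathcal{A})f$, and, when $n\ge 3$, $e\mathcal{A}e$ or $f\mathcal{A}f$ satisfies property (P) (defined in the context); and that one of the following statements also holds: (ii-1) $e\varphi(tm)e+f\varphi(mt)f\in\mathcal{Z}(\mathcal{A})$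 for each $m\in e\mathcal{A}f$ and $t\in f\mathcal{A}e$; (ii-2) $e\mathcal{A}e$ or $f\mathcal{A}f$ has no nonzero central ideal; (ii-3) $\mathcal{Z}(\mathcal{A})=\{a+b : a\in e\mathcal{Z}(\mathcal{A})e,\ b\in f\mathcal{Z}(\mathcal{A})f,\ am_0=m_0b\}$ for some $m_0\in e\mathcal{A}f$; (ii-4) $\mathcal{Z}(\mathcal{A})=\{a+b : a\in e\mathcal{Z}(\mathcal{A})e,\ b\in f\mathcal{Z}(\mathcal{A})f,\ t_0a=bt_0\}$ for some $t_0\in f\mathcal{A}e$; (ii-5) $e\mathcal{A}f\cdot f\mathcal{A}e=f\mathcal{A}e\cdot e\mathcal{A}f=\{0\}$. Then $\varphi$ is of the form $\varphi=d+\delta+\gamma$, where $d$ is a derivation on $\mathcal{A}$, $\delta$ is a singular Jordan derivation on $\mathcal{A}$, and $\gamma$ is a linear mapping from $\mathcal{A}$ into $\mathcal{Z}(\mathcal{A})$ vanishing on all $(n-1)$-th commutators of $\mathcal{A}$. In addition, $\delta$ is also an antiderivation on $\mathcal{A}$ when (ii-2) or (ii-5) holds. Furthermore, if it is further assumed that $n$ is even, or that $f\varphi(e\mathcal{A}f)e=e\varphi(f\mathcal{A}e)f=\{0\}$, then $\varphi$ is standard.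
   Context: Linear means $\mathcal{R}$-linear; $\mathcal{Z}(\cdot)$ denotes the centre. Nontrivial idempotent: $e^2=e$, $e\ne 0,1$. For a positive integer $k$, $\mathcal{A}$ is $k$-torsion free if $kx=0$ implies $x=0$ for each $x\in\mathcal{A}$. $[x,y]=xy-yx$, $x\circ y=xy+yx$. Define $p_1(x_1)=x_1$ and $p_n(x_1,\dots,x_n)=[p_{n-1}(x_1,\dots,x_{n-1}),x_n]$ for $n\ge2$; for $n\ge 2$, $p_n(x_1,\dots,x_n)$ is called an $(n-1)$-th commutator. A linear map $\varphi:\mathcal{A}\to\mathcal{A}$ is a Lie $n$-derivation if $\varphi(p_n(x_1,\dots,x_n))=\sum_{i=1}^n p_n(x_1,\dots,x_{i-1},\varphi(x_i),x_{i+1},\dots,x_n)$ for all $x_1,\dots,x_n\in\mathcal{A}$. A linear map $\delta:\mathcal{A}\to\mathcal{A}$ is a derivation if $\delta(xy)=\delta(x)y+x\delta(y)$, an antiderivation if $\delta(xy)=\delta(y)x+y\delta(x)$, and a Jordan derivation if $\delta(x\circ y)=\delta(x)\circ y+x\circ\delta(y)$, for all $x,y$. A Jordan derivation $\delta$ is singular (with respect to $e$) if $\delta(e\mathcal{A}e)=\{0\}$, $\delta(f\mathcal{A}f)=\{0\}$, $\delta(e\mathcal{A}f)\subseteq f\mathcal{A}e$ and $\delta(f\mathcal{A}e)\subseteq e\mathcal{A}f$. A Lie $n$-derivation is standard if it equals $h+\tau$ with $h$ a derivation on $\mathcal{A}$ and $\tau$ a linear mapping from $\mathcal{A}$ into $\mathcal{Z}(\mathcal{A})$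 vanishing on all $(n-1)$-th commutators of $\mathcal{A}$. For an algebra $\mathcal{B}$, $\mathcal{S}(\mathcal{B})$ is the subalgebra of $\mathcal{B}$ generated by all idempotents and all commutators of $\mathcal{B}$; a central ideal of $\mathcal{B}$ is an ideal contained in $\mathcal{Z}(\mathcal{B})$; $\mathcal{B}$ satisfies property (P) if for each $x\in\mathcal{B}$, $[x,\mathcal{B}]\subseteq\mathcal{Z}(\mathcal{B})$ implies $x\in\mathcal{Z}(\mathcal{B})$. $e\mathcal{A}e$ and $f\mathcal{A}f$ are regarded as unital algebras with units $e$ and $f$. *)

theory Defs
  imports Complex_Main
begin

text \<open>
  The classes \<^class>\<open>comm_ring_1\<close> and \<^class>\<open>ring_1\<close> demand \<open>0 \<noteq> 1\<close>. An algebra with a nontrivial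
  idempotent satisfies this, and so does any ring of scalars acting unitally on it.
\<close>

locale unital_algebra = module scale
  for scale :: "'r::comm_ring_1 \<Rightarrow> 'a::ring_1 \<Rightarrow> 'a" +
  assumes scale_mult_left: "scale r (x * y) = scale r x * y"
    and scale_mult_right: "scale r (x * y) = x * scale r y"

definition commutator :: "'a::ring_1 \<Rightarrow> 'a \<Rightarrow> 'a" where
  "commutator x y = x * y - y * x"

definition jordan_prod :: "'a::ring_1 \<Rightarrow> 'a \<Rightarrow> 'a" where
  "jordan_prod x y = x * y + y * x"

text \<open>
  \<open>lie_poly n x\<close> is $p_n(x_1,\dots,x_n)$. Only the entries of the sequence \<open>x\<close> with indices
  \<open>1, \<dots>, n\<close> matter, and the value for \<open>n = 0\<close> is a dummy.
\<close>

fun lie_poly :: "nat \<Rightarrow> (nat \<Rightarrow> 'a::ring_1) \<Rightarrow> 'a" where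
  "lie_poly 0 x = 0"
| "lie_poly (Suc 0) x = x 1"
| "lie_poly (Suc (Suc k)) x = commutator (lie_poly (Suc k) x) (x (Suc (Suc k)))"

definition sandwich :: "'a::ring_1 \<Rightarrow> 'a set \<Rightarrow> 'a \<Rightarrow> 'a set" where
  "sandwich e X f = {e * x * f | x. x \<in> X}"

text \<open>
  Algebras \<open>B\<close> below are given by their carriers, which are subsets of an ambient algebra and are
  typically \<open>UNIV\<close> or a corner \<open>sandwich e UNIV e\<close>. The unit of \<open>B\<close> need not be \<open>1\<close>.
\<close>

definition centre :: "'a::ring_1 set \<Rightarrow> 'a set" where
  "centre B = {z \<in> B. \<forall>x\<in>B. z * x = x * z}"

definition subalgebra :: "('r::comm_ring_1 \<Rightarrow> 'a::ring_1 \<Rightarrow> 'a) \<Rightarrow> 'a set \<Rightarrow> 'a set \<Rightarrow> bool" where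
  "subalgebra scale C B \<longleftrightarrow>
     C \<subseteq> B \<and> module.subspace scale C \<and> (\<forall>x\<in>C. \<forall>y\<in>C. x * y \<in> C)"

text \<open>
  A unit of \<open>B\<close> is among the idempotents, so it makes no difference for the next definition
  whether subalgebras are required to contain it.
\<close>

definition idem_comm_subalgebra ::
    "('r::comm_ring_1 \<Rightarrow> 'a::ring_1 \<Rightarrow> 'a) \<Rightarrow> 'a set \<Rightarrow> 'a set" where
  "idem_comm_subalgebra scale B =
     \<Inter> {C. subalgebra scale C B \<and> {p \<in> B. p * p = p} \<subseteq> C
             \<and> {commutator x y | x y. x \<in> B \<and> y \<in> B} \<subseteq> C}"

definition algebra_ideal :: "('r::comm_ring_1 \<Rightarrow> 'a::ring_1 \<Rightarrow> 'a) \<Rightarrow> 'a set \<Rightarrow> 'a set \<Rightarrow> bool" where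
  "algebra_ideal scale I B \<longleftrightarrow>
     I \<subseteq> B \<and> module.subspace scale I \<and> (\<forall>x\<in>I. \<forall>b\<in>B. b * x \<in> I \<and> x * b \<in> I)"

definition central_ideal :: "('r::comm_ring_1 \<Rightarrow> 'a::ring_1 \<Rightarrow> 'a) \<Rightarrow> 'a set \<Rightarrow> 'a set \<Rightarrow> bool" where
  "central_ideal scale I B \<longleftrightarrow> algebra_ideal scale I B \<and> I \<subseteq> centre B"

definition property_P :: "'a::ring_1 set \<Rightarrow> bool" where
  "property_P B \<longleftrightarrow> (\<forall>x\<in>B. commutator x ` B \<subseteq> centre B \<longrightarrow> x \<in> centre B)"

definition lie_n_derivation ::
    "('r::comm_ring_1 \<Rightarrow> 'a::ring_1 \<Rightarrow> 'a) \<Rightarrow> nat \<Rightarrow> ('a \<Rightarrow> 'a) \<Rightarrow> bool" where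
  "lie_n_derivation scale n \<phi> \<longleftrightarrow>
     module_hom scale scale \<phi> \<and>
     (\<forall>x. \<phi> (lie_poly n x) = (\<Sum>i = 1..n. lie_poly n (x(i := \<phi> (x i)))))"

definition derivation :: "('r::comm_ring_1 \<Rightarrow> 'a::ring_1 \<Rightarrow> 'a) \<Rightarrow> ('a \<Rightarrow> 'a) \<Rightarrow> bool" where
  "derivation scale \<delta> \<longleftrightarrow>
     module_hom scale scale \<delta> \<and> (\<forall>x y. \<delta> (x * y) = \<delta> x * y + x * \<delta> y)"

definition antiderivation :: "('r::comm_ring_1 \<Rightarrow> 'a::ring_1 \<Rightarrow> 'a) \<Rightarrow> ('a \<Rightarrow> 'a) \<Rightarrow> bool" where
  "antiderivation scale \<delta> \<longleftrightarrow>
     module_hom scale scale \<delta> \<and> (\<forall>x y. \<delta> (x * y) = \<delta> y * x + y * \<delta> x)"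

definition jordan_derivation :: "('r::comm_ring_1 \<Rightarrow> 'a::ring_1 \<Rightarrow> 'a) \<Rightarrow> ('a \<Rightarrow> 'a) \<Rightarrow> bool" where
  "jordan_derivation scale \<delta> \<longleftrightarrow>
     module_hom scale scale \<delta> \<and>
     (\<forall>x y. \<delta> (jordan_prod x y) = jordan_prod (\<delta> x) y + jordan_prod x (\<delta> y))"

definition singular_jordan_derivation ::
    "('r::comm_ring_1 \<Rightarrow> 'a::ring_1 \<Rightarrow> 'a) \<Rightarrow> 'a \<Rightarrow> ('a \<Rightarrow> 'a) \<Rightarrow> bool" where
  "singular_jordan_derivation scale e \<delta> \<longleftrightarrow>
     jordan_derivation scale \<delta> \<and>
     (let f = 1 - e in
        \<delta> ` sandwich e UNIV e = {0} \<and>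
        \<delta> ` sandwich f UNIV f = {0} \<and>
        \<delta> ` sandwich e UNIV f \<subseteq> sandwich f UNIV e \<and>
        \<delta> ` sandwich f UNIV e \<subseteq> sandwich e UNIV f)"

definition central_map_vanishing ::
    "('r::comm_ring_1 \<Rightarrow> 'a::ring_1 \<Rightarrow> 'a) \<Rightarrow> nat \<Rightarrow> ('a \<Rightarrow> 'a) \<Rightarrow> bool" where
  "central_map_vanishing scale n \<tau> \<longleftrightarrow>
     module_hom scale scale \<tau> \<and> range \<tau> \<subseteq> centre UNIV \<and> (\<forall>x. \<tau> (lie_poly n x) = 0)"

definition standard_lie_n_derivation ::
    "('r::comm_ring_1 \<Rightarrow> 'a::ring_1 \<Rightarrow> 'a) \<Rightarrow> nat \<Rightarrow> ('a \<Rightarrow> 'a) \<Rightarrow> bool" where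
  "standard_lie_n_derivation scale n \<phi> \<longleftrightarrow>
     lie_n_derivation scale n \<phi> \<and>
     (\<exists>h \<tau>. derivation scale h \<and> central_map_vanishing scale n \<tau> \<and> (\<forall>x. \<phi> x = h x + \<tau> x))"

end

theory Submission
  imports Defs
begin

text \<open>
  The idempotent \<open>e\<close> makes the algebra \<open>\<int>/2\<close>-graded: the even elements are those of
  $e\mathcal{A}e + f\mathcal{A}f$, which commute with \<open>s = f - e\<close>, and the odd elements are those of
  $e\mathcal{A}f + f\mathcal{A}e$, which anticommute with \<open>s\<close>. Since \<open>s\<close> squares to \<open>1\<close> and
  \<open>[y, e] = s * y\<close> for odd \<open>y\<close>, filling slots of $p_n$ with \<open>e\<close> only multiplies an odd element by a power
  of \<open>s\<close>. This turns the identity for $p_n$ into identities for ordinary commutators.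

  After subtraction of an inner derivation, \<open>\<phi> e\<close> is even. Then \<open>\<phi>\<close> preserves the grading and \<open>\<phi> e\<close>
  is central; this step (\<open>e_central\<close>) is the one that divides by \<open>n - 1\<close>. On odd elements \<open>\<phi>\<close> is the sum of
  a part that commutes with multiplication by \<open>s\<close> and a part that anticommutes with it. Replacing
  arguments \<open>y\<close> by \<open>s * y\<close> separates the identities for the two parts. The anticommuting part \<open>\<delta>\<close>
  is a singular Jordan derivation. For even \<open>n\<close> the map \<open>\<phi>\<close> itself commutes with \<open>s\<close> on odd elements,
  so that \<open>\<delta> = 0\<close>. The remaining part \<open>\<psi>\<close> satisfies the Leibniz rule for every commutator with at least
  one odd argument.

  By the Jacobi identity, \<open>\<psi>\<close> is then a Lie derivation modulo the centre on even elements as well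
  (\<open>lie_defect_central\<close>). Each of the first group of alternative hypotheses implies that \<open>\<psi>\<close> maps either
  corner into that corner plus the centre. A corner contains no central element but \<open>0\<close>, so the central
  summand is unique and linear; collecting it in \<open>\<gamma>\<close>, the map \<open>d = \<psi> - \<gamma>\<close> preserves all four
  blocks. The Leibniz rule for \<open>d\<close> on products with an even factor follows from the commutator
  identities and faithfulness. For odd factors, the defect
  \<open>u y y' = d (y * y') - d y * y' - y * d y'\<close> is a bimodule map and a cocycle, and
  \<open>u y y' - u y' y\<close> is central. Each of the second group of alternatives forces \<open>u = 0\<close>: for instance, in
  the absence of central ideals, because \<open>u y y'\<close> with \<open>y\<close> in $e\mathcal{A}f$ generates a central ideal of
  $e\mathcal{A}e$. The same argument, applied to \<open>[y, \<delta> y']\<close>, makes \<open>\<delta>\<close> an antiderivation.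

  Finally \<open>\<gamma> = \<phi> - d - \<delta>\<close> is a Lie \<open>n\<close>-derivation with central values, and every term of its
  Leibniz sum vanishes.
\<close>

lemma commutator_simps:
  "commutator (x + y) z = commutator x z + commutator y z"
  "commutator x (y + z) = commutator x y + commutator x z"
  "commutator (x - y) z = commutator x z - commutator y z"
  "commutator x (y - z) = commutator x y - commutator x z"
  "commutator (- x) z = - commutator x z"
  "commutator x (- z) = - commutator x z"
  "commutator 0 z = 0"
  "commutator x 0 = 0"
  "commutator x x = 0"
  for x y z :: "'a::ring_1"
  by (simp_all add: commutator_def algebra_simps)

lemma commutator_central:
  "z \<in> centre UNIV \<Longrightarrow> commutator x z = 0"
  "z \<in> centre UNIV \<Longrightarrow> commutator z x = 0"
  by (auto simp: commutator_def centre_def)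


section \<open>Lie polynomials and their Leibniz sums\<close>

text \<open>
  The sum in the definition of a Lie \<open>n\<close>-derivation, arranged as a recursion on \<open>n\<close>: the value of
  \<open>h\<close> sits either in one of the first slots or in the last one.
\<close>

fun lie_leibniz :: "('a::ring_1 \<Rightarrow> 'a) \<Rightarrow> nat \<Rightarrow> (nat \<Rightarrow> 'a) \<Rightarrow> 'a" where
  "lie_leibniz h 0 x = 0"
| "lie_leibniz h (Suc 0) x = h (x 1)"
| "lie_leibniz h (Suc (Suc k)) x =
     commutator (lie_leibniz h (Suc k) x) (x (Suc (Suc k)))
     + commutator (lie_poly (Suc k) x) (h (x (Suc (Suc k))))"

lemma lie_poly_cong:
  "(\<And>i. 1 \<le> i \<Longrightarrow> i \<le> n \<Longrightarrow> x i = y i) \<Longrightarrow> lie_poly n x = lie_poly n y"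
  by (induction n x rule: lie_poly.induct) auto

lemma lie_poly_upd_above [simp]:
  "n < i \<Longrightarrow> lie_poly n (x(i := v)) = lie_poly n x"
  by (rule lie_poly_cong) auto

lemma commutator_sum_left:
  "commutator (\<Sum>i\<in>I. u i) v = (\<Sum>i\<in>I. commutator (u i) (v::'a::ring_1))"
  by (simp add: commutator_def sum_distrib_left sum_distrib_right sum_subtractf)

lemma sum_lie_poly_eq_leibniz:
  "(\<Sum>i = 1..n. lie_poly n (x(i := h (x i)))) = lie_leibniz h n x"
proof (induction h n x rule: lie_leibniz.induct)
  case (3 h k x)
  have "(\<Sum>i = 1..Suc k. lie_poly (Suc (Suc k)) (x(i := h (x i))))
      = (\<Sum>i = 1..Suc k. commutator (lie_poly (Suc k) (x(i := h (x i)))) (x (Suc (Suc k))))"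
    by (rule sum.cong) auto
  also have "\<dots> = commutator (lie_leibniz h (Suc k) x) (x (Suc (Suc k)))"
    by (simp only: commutator_sum_left[symmetric] 3)
  moreover have "lie_poly (Suc (Suc k)) (x(Suc (Suc k) := h (x (Suc (Suc k)))))
      = commutator (lie_poly (Suc k) x) (h (x (Suc (Suc k))))"
    using lie_poly_upd_above[of "Suc k" "Suc (Suc k)" x] by simp
  ultimately show ?case
    by (subst sum.cl_ivl_Suc) (simp del: sum.cl_ivl_Suc fun_upd_apply)
qed auto

lemma lie_n_derivation_iff:
  "lie_n_derivation scale n h \<longleftrightarrow>
     module_hom scale scale h \<and> (\<forall>x. h (lie_poly n x) = lie_leibniz h n x)"
  unfolding lie_n_derivation_def sum_lie_poly_eq_leibniz ..

lemma lie_leibniz_diff: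
  "lie_leibniz (\<lambda>x. g x - h x) n x = lie_leibniz g n x - lie_leibniz h n x"
  by (induction h n x rule: lie_leibniz.induct) (simp_all add: commutator_simps)

lemma lie_leibniz_derivation:
  assumes "h 0 = 0" "\<And>x y. h (commutator x y) = commutator (h x) y + commutator x (h y)"
  shows "lie_leibniz h n x = h (lie_poly n x)"
  by (induction h\<equiv>h n x rule: lie_leibniz.induct) (simp_all add: assms)

text \<open>
  For odd length, $p_{2k+1}$ is an iterated double commutator, so it suffices that \<open>h\<close> is a Lie
  triple derivation. This is the way in which singular Jordan derivations, which need not be
  Lie derivations, enter for odd \<open>n\<close>.
\<close>

lemma lie_leibniz_triple_derivation:
  assumes "h 0 = 0"
    "\<And>x y z. h (commutator (commutator x y) z) =
       commutator (commutator (h x) y) z + commutator (commutator x (h y)) z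
       + commutator (commutator x y) (h z)"
  shows "lie_leibniz h (Suc (2 * k)) x = h (lie_poly (Suc (2 * k)) x)"
  by (induction k) (simp_all add: assms commutator_simps)

text \<open>
  In each summand a central element occurs inside a commutator; for \<open>n = 1\<close> there would be none.
\<close>

lemma lie_leibniz_central:
  assumes "range h \<subseteq> centre UNIV" "n \<ge> 2"
  shows "lie_leibniz h n x = 0"
proof -
  have z: "h y \<in> centre UNIV" for y
    using assms(1) by auto
  have "lie_leibniz h (Suc (Suc k)) x = 0" for k
    by (induction k) (simp_all add: commutator_central z commutator_simps)
  then show ?thesis
    using assms(2) by (metis Suc_le_D numeral_2_eq_2 Suc_le_mono)
qed


section \<open>The grading attached to an idempotent\<close>

text \<open>
  The assumption \<open>faithful\<close> is the joint form of the two faithfulness conditions on the corners: an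
  element \<open>w\<close> commuting with \<open>e\<close> is the sum of its two corner components, and annihilating every
  \<open>y\<close> with \<open>e * y = y * f\<close> on both sides means the same for each component. In this form all
  assumptions are symmetric under exchanging \<open>e\<close> and \<open>f\<close>.
\<close>

locale peirce = unital_algebra scale
  for scale :: "'r::comm_ring_1 \<Rightarrow> 'a::ring_1 \<Rightarrow> 'a" +
  fixes e f :: 'a
  assumes idem_e [simp]: "e * e = e"
    and f_eq: "f = 1 - e"
    and two_torsion_free: "x + x = 0 \<Longrightarrow> x = (0::'a)"
    and faithful: "\<lbrakk>e * w = w * e; \<And>y. e * y = y * f \<Longrightarrow> w * y = 0 \<and> y * w = 0\<rbrakk> \<Longrightarrow> w = 0"
begin

definition diag :: "'a set" where "diag = {x. e * x = x * e}"
definition offdiag :: "'a set" where "offdiag = {y. e * y = y * f}"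

lemma diag_iff: "x \<in> diag \<longleftrightarrow> e * x = x * e"
  and offdiag_iff: "y \<in> offdiag \<longleftrightarrow> e * y = y * f"
  by (simp_all add: diag_def offdiag_def)

text \<open>
  The sign element of the grading. With this choice of sign, commutation with \<open>e\<close> acts on odd elements
  as left multiplication by \<open>s\<close>.
\<close>

definition s :: 'a where "s = f - e"

lemma double_cancel: "x + x = y + y \<Longrightarrow> x = (y::'a)"
  using two_torsion_free[of "x - y"] by (simp add: algebra_simps)

lemma eq_minus_imp_zero: "x = - x \<Longrightarrow> x = (0::'a)"
  using two_torsion_free[of x] by (metis add.right_inverse)

lemma idem_f [simp]: "f * f = f" and ef [simp]: "e * f = 0" and fe [simp]: "f * e = 0"
  and e_plus_f: "e + f = 1"
  by (simp_all add: f_eq algebra_simps)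

lemma ef_absorb [simp]:
  "e * (e * x) = e * x" "f * (f * x) = f * x" "e * (f * x) = 0" "f * (e * x) = 0"
  by (simp_all add: mult.assoc[symmetric])

lemma e_plus_f_mult: "e * x + f * x = x" "x * e + x * f = x"
  by (simp_all add: f_eq algebra_simps)

lemma s_simps [simp]:
  "s * s = 1" "e * s = - e" "f * s = f" "s * e = - e" "s * f = f"
  "s * (s * x) = x" "e * (s * x) = - (e * x)" "f * (s * x) = f * x"
  "s * (e * x) = - (e * x)" "s * (f * x) = f * x"
proof -
  show "s * s = 1"
    using e_plus_f by (simp add: s_def left_diff_distrib right_diff_distrib add.commute)
  show "e * s = - e" "f * s = f" "s * e = - e" "s * f = f"
    by (simp_all add: s_def left_diff_distrib right_diff_distrib)
  show "s * (e * x) = - (e * x)" "s * (f * x) = f * x"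
    by (simp_all add: s_def left_diff_distrib)
  show "e * (s * x) = - (e * x)" "f * (s * x) = f * x"
    by (simp_all add: s_def left_diff_distrib right_diff_distrib)
  have "s * (s * x) = e * x + f * x"
    by (simp add: s_def left_diff_distrib right_diff_distrib)
  then show "s * (s * x) = x"
    by (simp add: e_plus_f_mult)
qed

lemma s_cancel: "s * x = s * y \<longleftrightarrow> x = y"
  by (metis s_simps(6))

text \<open>
  The rules in \<open>graded\<close> move \<open>e\<close>, \<open>f\<close> and \<open>s\<close> to the left of homogeneous elements; together with
  \<open>mult.assoc\<close> they decide the identities needed below.
\<close>

lemma diag_commute:
  assumes "x \<in> diag"
  shows "x * e = e * x" "x * (e * z) = e * (x * z)" "x * f = f * x" "x * (f * z) = f * (x * z)"
    "x * s = s * x" "x * (s * z) = s * (x * z)"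
proof -
  show a: "x * e = e * x" "x * f = f * x"
    using assms by (simp_all add: diag_def f_eq left_diff_distrib right_diff_distrib)
  show b: "x * s = s * x"
    by (simp add: s_def left_diff_distrib right_diff_distrib a)
  note 1 = a b
  show "x * (e * z) = e * (x * z)" "x * (f * z) = f * (x * z)" "x * (s * z) = s * (x * z)"
    by (simp_all flip: mult.assoc add: 1 del: ef_absorb s_simps)
qed

lemma offdiag_commute:
  assumes "y \<in> offdiag"
  shows "y * e = f * y" "y * (e * z) = f * (y * z)" "y * f = e * y" "y * (f * z) = e * (y * z)"
    "y * s = - (s * y)" "y * (s * z) = - (s * (y * z))"
proof -
  show a2: "y * f = e * y"
    using assms by (simp add: offdiag_def)
  show a1: "y * e = f * y"
    using e_plus_f_mult[of y] unfolding a2 by (metis add.commute add_left_cancel)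
  note a = a1 a2
  show b: "y * s = - (s * y)"
    by (simp add: s_def left_diff_distrib right_diff_distrib a)
  note 1 = a b
  show "y * (e * z) = f * (y * z)" "y * (f * z) = e * (y * z)" "y * (s * z) = - (s * (y * z))"
    by (simp_all flip: mult.assoc add: 1 del: ef_absorb s_simps)
qed

lemmas graded = diag_commute offdiag_commute

lemma diag_closed [simp, intro]:
  "0 \<in> diag" "1 \<in> diag" "e \<in> diag" "f \<in> diag" "s \<in> diag"
  "x \<in> diag \<Longrightarrow> y \<in> diag \<Longrightarrow> x + y \<in> diag"
  "x \<in> diag \<Longrightarrow> y \<in> diag \<Longrightarrow> x - y \<in> diag"
  "x \<in> diag \<Longrightarrow> - x \<in> diag"
  "x \<in> diag \<Longrightarrow> y \<in> diag \<Longrightarrow> x * y \<in> diag"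
proof -
  show "x * y \<in> diag" if "x \<in> diag" "y \<in> diag"
    using that unfolding diag_def by simp (metis mult.assoc)
qed (auto simp: diag_def ring_distribs)

lemma offdiag_closed [simp, intro]:
  "0 \<in> offdiag"
  "x \<in> offdiag \<Longrightarrow> y \<in> offdiag \<Longrightarrow> x + y \<in> offdiag"
  "x \<in> offdiag \<Longrightarrow> y \<in> offdiag \<Longrightarrow> x - y \<in> offdiag"
  "x \<in> offdiag \<Longrightarrow> - x \<in> offdiag"
  by (auto simp: offdiag_def ring_distribs)

lemma graded_mult [simp, intro]:
  "x \<in> diag \<Longrightarrow> y \<in> offdiag \<Longrightarrow> x * y \<in> offdiag"
  "x \<in> diag \<Longrightarrow> y \<in> offdiag \<Longrightarrow> y * x \<in> offdiag"
  "y \<in> offdiag \<Longrightarrow> z \<in> offdiag \<Longrightarrow> y * z \<in> diag"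
proof -
  show "x * y \<in> offdiag" "y * x \<in> offdiag" if "x \<in> diag" "y \<in> offdiag"
    using that unfolding offdiag_iff[of "x * y"] offdiag_iff[of "y * x"]
    by (simp_all add: mult.assoc graded)
  show "y * z \<in> diag" if "y \<in> offdiag" "z \<in> offdiag"
    unfolding diag_def mem_Collect_eq
    using that by (simp add: mult.assoc graded)
qed

lemma graded_commutator [simp, intro]:
  "x \<in> diag \<Longrightarrow> y \<in> diag \<Longrightarrow> commutator x y \<in> diag"
  "x \<in> diag \<Longrightarrow> y \<in> offdiag \<Longrightarrow> commutator x y \<in> offdiag"
  "x \<in> diag \<Longrightarrow> y \<in> offdiag \<Longrightarrow> commutator y x \<in> offdiag"
  "y \<in> offdiag \<Longrightarrow> z \<in> offdiag \<Longrightarrow> commutator y z \<in> diag"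
  by (simp_all add: commutator_def)

lemma diag_offdiag_zero: "x \<in> diag \<Longrightarrow> x \<in> offdiag \<Longrightarrow> x = 0"
proof -
  assume "x \<in> diag" "x \<in> offdiag"
  then have "f * x = e * x"
    using diag_commute(1)[of x] offdiag_commute(1)[of x] by simp
  moreover from this have "e * x = 0"
    by (metis ef_absorb(1,3))
  ultimately show "x = 0"
    using e_plus_f_mult(1)[of x] by simp
qed

definition even_part :: "'a \<Rightarrow> 'a" where "even_part x = e * x * e + f * x * f"
definition odd_part :: "'a \<Rightarrow> 'a" where "odd_part x = e * x * f + f * x * e"

lemma even_part_diag [simp]: "even_part x \<in> diag"
  and odd_part_offdiag [simp]: "odd_part x \<in> offdiag"
  by (simp_all add: diag_iff offdiag_iff even_part_def odd_part_def ring_distribs mult.assoc)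

lemma even_odd: "even_part x + odd_part x = x"
  using e_plus_f_mult(2)[of "e * x"] e_plus_f_mult(2)[of "f * x"] e_plus_f_mult(1)[of x]
  unfolding even_part_def odd_part_def by (metis add.assoc add.commute)

lemma grading_cases:
  obtains x0 x1 where "x = x0 + x1" "x0 \<in> diag" "x1 \<in> offdiag"
  using even_odd[of x] even_part_diag odd_part_offdiag by metis

lemma odd_part_simps [simp]:
  "x \<in> diag \<Longrightarrow> odd_part x = 0" "y \<in> offdiag \<Longrightarrow> odd_part y = y"
  by (simp_all add: odd_part_def graded mult.assoc e_plus_f_mult)

lemma odd_part_eq_0: "odd_part x = 0 \<Longrightarrow> x \<in> diag"
  by (metis even_odd even_part_diag add.right_neutral)

lemma commutator_offdiag_e: "y \<in> offdiag \<Longrightarrow> commutator y e = s * y"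
  by (simp add: commutator_def graded s_def ring_distribs)

lemma commutator_e: "commutator x e = s * odd_part x"
proof -
  have "commutator x e = commutator (even_part x) e + commutator (odd_part x) e"
    by (metis even_odd commutator_simps(1))
  then show ?thesis
    by (simp add: commutator_offdiag_e) (simp add: commutator_def graded)
qed

text \<open>
  Commuting with odd elements is enough. If \<open>z\<close> is even and commutes with all odd elements, and \<open>d\<close> is
  even, then \<open>z * d - d * z\<close> annihilates the odd elements because \<open>d * y\<close> and \<open>y * d\<close> are again odd;
  faithfulness applies.
\<close>

lemma centralI:
  assumes "z \<in> diag" and "\<And>y. y \<in> offdiag \<Longrightarrow> commutator z y = 0"
  shows "z \<in> centre UNIV"
proof -
  have y: "z * y = y * z" if "y \<in> offdiag" for y
    using assms(2)[OF that] by (simp add: commutator_def)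
  have d: "z * d = d * z" if d: "d \<in> diag" for d
  proof -
    have "z * d - d * z = 0"
    proof (rule faithful)
      show "e * (z * d - d * z) = (z * d - d * z) * e"
        using assms(1) d by (simp add: diag_def[symmetric] graded algebra_simps)
      fix y assume "e * y = y * f"
      then have o: "y \<in> offdiag" by (simp add: offdiag_def)
      have "z * (d * y) = d * (z * y)" "y * (d * z) = z * (y * d)" "y * (z * d) = z * (y * d)"
        using y[OF o] y[of "d * y"] y[of "y * d"] d o by (simp_all, simp_all add: mult.assoc)
          (metis mult.assoc)
      then show "(z * d - d * z) * y = 0 \<and> y * (z * d - d * z) = 0"
        by (simp add: algebra_simps)
    qed
    then show ?thesis by simp
  qed
  have "z * x = x * z" for x
    by (rule grading_cases[of x]) (simp add: d y algebra_simps)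
  then show ?thesis by (simp add: centre_def)
qed

lemma central_commute: "z \<in> centre UNIV \<Longrightarrow> x * z = z * x"
  by (simp add: centre_def)

lemma central_diag: "z \<in> centre UNIV \<Longrightarrow> z \<in> diag"
  by (simp add: centre_def diag_def)

lemma central_closed [simp, intro]:
  "0 \<in> centre (UNIV :: 'a set)"
  "z \<in> centre (UNIV :: 'a set) \<Longrightarrow> w \<in> centre UNIV \<Longrightarrow> z + w \<in> centre UNIV"
  "z \<in> centre (UNIV :: 'a set) \<Longrightarrow> w \<in> centre UNIV \<Longrightarrow> z - w \<in> centre UNIV"
  "z \<in> centre (UNIV :: 'a set) \<Longrightarrow> - z \<in> centre UNIV"
  "z \<in> centre (UNIV :: 'a set) \<Longrightarrow> scale r z \<in> centre UNIV"
  by (auto simp: centre_def algebra_simps scale_mult_left[symmetric] scale_mult_right[symmetric])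

text \<open>
  A central element with \<open>e * z = 0\<close> kills \<open>e * y\<close> directly and \<open>f * y\<close> after being moved to the
  right of \<open>y\<close>, hence all odd elements.
\<close>

lemma central_zero:
  assumes "z \<in> centre UNIV" "g \<in> {e, f}" "g * z = 0"
  shows "z = 0"
proof (rule faithful)
  show "e * z = z * e" using assms(1) by (simp add: centre_def)
  fix y assume "e * y = y * f"
  then have o: "y \<in> offdiag" by (simp add: offdiag_def)
  have "e * (z * y) = 0 \<and> f * (z * y) = 0"
  proof (cases "g = e")
    case True
    then have "e * z = 0"
      using assms(3) by simp
    then have "e * (z * y) = 0" "y * (e * z) = 0"
      using mult.assoc[of g z y] True assms(3) by simp_all
    moreover have "f * (z * y) = y * (e * z)"
      using o central_commute[OF assms(1), of y] by (simp add: graded)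
    ultimately show ?thesis by simp
  next
    case False
    then have "f * z = 0"
      using assms(2,3) by simp
    then have "f * (z * y) = 0" "y * (f * z) = 0"
      using mult.assoc[of g z y] False assms(2,3) by auto
    moreover have "e * (z * y) = y * (f * z)"
      using o central_commute[OF assms(1), of y] by (simp add: graded)
    ultimately show ?thesis by simp
  qed
  then have "z * y = 0" using e_plus_f_mult(1)[of "z * y"] by simp
  then show "z * y = 0 \<and> y * z = 0"
    using central_commute[OF assms(1), of y] by simp
qed

lemma faithful_diag:
  "\<lbrakk>w \<in> diag; \<And>y. y \<in> offdiag \<Longrightarrow> w * y = 0; \<And>y. y \<in> offdiag \<Longrightarrow> y * w = 0\<rbrakk> \<Longrightarrow> w = 0"
  by (rule faithful) (auto simp: diag_def offdiag_def)

lemma sandwich_diag: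
  assumes "g \<in> {e, f}"
  shows "sandwich g UNIV g = {x \<in> diag. g * x = x}"
proof (intro equalityI subsetI)
  fix x assume "x \<in> sandwich g UNIV g"
  then obtain a where "x = g * a * g"
    by (auto simp: sandwich_def)
  then show "x \<in> {x \<in> diag. g * x = x}"
    using assms by (auto simp: diag_iff mult.assoc)
next
  fix x assume "x \<in> {x \<in> diag. g * x = x}"
  then have "x = g * x * g"
    using assms by (auto simp: graded)
  then show "x \<in> sandwich g UNIV g"
    by (auto simp: sandwich_def)
qed

lemma sandwich_offdiag:
  assumes "(g, h) \<in> {(e, f), (f, e)}"
  shows "sandwich g UNIV h = {y \<in> offdiag. g * y = y}"
proof (intro equalityI subsetI)
  fix x assume "x \<in> sandwich g UNIV h"
  then obtain a where "x = g * a * h"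
    by (auto simp: sandwich_def)
  then show "x \<in> {y \<in> offdiag. g * y = y}"
    using assms by (auto simp: offdiag_iff mult.assoc)
next
  fix x assume "x \<in> {y \<in> offdiag. g * y = y}"
  then have "x = g * x * h"
    using assms by (auto simp: graded)
  then show "x \<in> sandwich g UNIV h"
    by (auto simp: sandwich_def)
qed

end

section \<open>Corners\<close>

context peirce
begin

text \<open>
  Statements about one corner are proved for a pair \<open>(g, h)\<close> which is \<open>(e, f)\<close> or \<open>(f, e)\<close>, so that
  both corners, and both odd blocks, are covered at once.
\<close>

definition complementary :: "'a \<Rightarrow> 'a \<Rightarrow> bool" where
  "complementary g h \<longleftrightarrow> (g, h) \<in> {(e, f), (f, e)}"

definition corner :: "'a \<Rightarrow> 'a set" where
  "corner g = {x \<in> diag. g * x = x}"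

lemma complementary_sym: "complementary g h \<Longrightarrow> complementary h g"
  by (auto simp: complementary_def)

lemma complementary_ef [simp]: "complementary e f" "complementary f e"
  by (auto simp: complementary_def)

lemma complementary_simps:
  assumes "complementary g h"
  shows "g * g = g" "h * h = h" "g * h = 0" "h * g = 0"
    "g * (g * x) = g * x" "h * (h * x) = h * x" "g * (h * x) = 0" "h * (g * x) = 0"
    "g \<in> diag" "h \<in> diag"
    "x \<in> diag \<Longrightarrow> x * g = g * x" "x \<in> diag \<Longrightarrow> x * (g * z) = g * (x * z)"
    "x \<in> diag \<Longrightarrow> x * h = h * x" "x \<in> diag \<Longrightarrow> x * (h * z) = h * (x * z)"
    "x \<in> offdiag \<Longrightarrow> x * g = h * x" "x \<in> offdiag \<Longrightarrow> x * (g * z) = h * (x * z)"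
    "x \<in> offdiag \<Longrightarrow> x * h = g * x" "x \<in> offdiag \<Longrightarrow> x * (h * z) = g * (x * z)"
    "g * scale r x = scale r (g * x)" "h * scale r x = scale r (h * x)"
  using assms by (auto simp: complementary_def graded scale_mult_right)

lemma complementary_sum: "complementary g h \<Longrightarrow> g * x + h * x = x"
  using e_plus_f_mult(1)[of x] by (auto simp: complementary_def add.commute)

lemma sandwich_corner: "complementary g h \<Longrightarrow> sandwich g UNIV g = corner g"
  using sandwich_diag[of g] by (auto simp: complementary_def corner_def)

lemma corner_iff: "complementary g h \<Longrightarrow> x \<in> corner g \<longleftrightarrow> x \<in> diag \<and> h * x = 0"
  using complementary_sum[of g h x] by (auto simp: corner_def complementary_simps)

lemma corner_diag: "x \<in> corner g \<Longrightarrow> x \<in> diag"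
  by (simp add: corner_def)

lemma corner_mult:
  "a \<in> corner g \<Longrightarrow> x \<in> diag \<Longrightarrow> a * x \<in> corner g"
  "complementary g h \<Longrightarrow> a \<in> corner g \<Longrightarrow> x \<in> diag \<Longrightarrow> x * a \<in> corner g"
proof -
  show "a * x \<in> corner g" if "a \<in> corner g" "x \<in> diag"
    using that by (simp add: corner_def flip: mult.assoc)
  show "x * a \<in> corner g" if "complementary g h" "a \<in> corner g" "x \<in> diag"
    using that complementary_simps(12)[OF that(1,3), of a] by (simp add: corner_def)
qed

lemma corner_closed:
  "a \<in> corner g \<Longrightarrow> b \<in> corner g \<Longrightarrow> a + b \<in> corner g"
  "a \<in> corner g \<Longrightarrow> b \<in> corner g \<Longrightarrow> a - b \<in> corner g"
  "0 \<in> corner g"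
  by (auto simp: corner_def ring_distribs)

lemma scale_diag [simp]: "x \<in> diag \<Longrightarrow> scale r x \<in> diag"
  by (simp add: diag_iff scale_mult_left[symmetric] scale_mult_right[symmetric])

lemma corner_scale: "complementary g h \<Longrightarrow> a \<in> corner g \<Longrightarrow> scale r a \<in> corner g"
  by (simp add: corner_def complementary_simps)

lemma corner_offdiag:
  assumes "complementary g h" "a \<in> corner g" "y \<in> offdiag"
  shows "g * y = y \<Longrightarrow> y * a = 0" "h * y = y \<Longrightarrow> a * y = 0"
    "g * y = y \<Longrightarrow> commutator a y = a * y" "h * y = y \<Longrightarrow> commutator a y = - (y * a)"
proof -
  have 1: "y * a = 0" if "g * y = y"
  proof -
    have "y * a = y * (g * a)" using assms(2) by (simp add: corner_def)
    also have "\<dots> = h * (g * y * a)" using assms(1,3) that by (simp add: complementary_simps)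
    finally show ?thesis using assms(1) by (simp add: mult.assoc complementary_simps)
  qed
  have 2: "a * y = 0" if "h * y = y"
  proof -
    have "a * (h * y) = h * a * y"
      using complementary_simps(14)[OF assms(1) corner_diag[OF assms(2)]] by (simp add: mult.assoc)
    moreover have "h * a = 0"
      using assms by (simp add: corner_iff)
    ultimately show ?thesis using that by simp
  qed
  show "g * y = y \<Longrightarrow> y * a = 0" "h * y = y \<Longrightarrow> a * y = 0"
    "g * y = y \<Longrightarrow> commutator a y = a * y" "h * y = y \<Longrightarrow> commutator a y = - (y * a)"
    using 1 2 by (simp_all add: commutator_def)
qed

lemma corner_annihilate:
  assumes "complementary g h" "a \<in> corner g" "b \<in> corner h"
  shows "a * b = 0" "b * a = 0"
proof -
  have "h * a = 0" "g * b = 0"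
    using assms(2,3) corner_iff[OF assms(1)] corner_iff[OF complementary_sym[OF assms(1)]]
      by simp_all
  moreover have "a * b = a * (h * b)" "b * a = b * (g * a)"
    using assms(2,3) by (simp_all add: corner_def)
  moreover have "a * (h * b) = h * a * b" "b * (g * a) = g * b * a"
    using complementary_simps(14)[OF assms(1) corner_diag[OF assms(2)]]
      complementary_simps(12)[OF assms(1) corner_diag[OF assms(3)]] by (simp_all add: mult.assoc)
  ultimately show "a * b = 0" "b * a = 0" by simp_all
qed

lemma jacobi:
  "commutator (commutator x y) z = commutator x (commutator y z) - commutator y (commutator x z)"
  for x y z :: 'a
  by (simp add: commutator_def ring_distribs mult.assoc)

end


section \<open>Graded Lie maps\<close>

text \<open>
  The properties that the part of a normalised Lie \<open>n\<close>-derivation commuting with \<open>s\<close> turns out to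
  have. The Leibniz rule for a commutator of two even elements is not among them.
\<close>

locale graded_lie_map = peirce scale e f
  for scale :: "'r::comm_ring_1 \<Rightarrow> 'a::ring_1 \<Rightarrow> 'a" and e f :: 'a +
  fixes \<psi> :: "'a \<Rightarrow> 'a"
  assumes hom: "module_hom scale scale \<psi>"
    and diag: "x \<in> diag \<Longrightarrow> \<psi> x \<in> diag"
    and offdiag: "y \<in> offdiag \<Longrightarrow> \<psi> y \<in> offdiag"
    and s_mult: "y \<in> offdiag \<Longrightarrow> \<psi> (s * y) = s * \<psi> y"
    and diag_offdiag: "\<lbrakk>x \<in> diag; y \<in> offdiag\<rbrakk> \<Longrightarrow>
       \<psi> (commutator x y) = commutator (\<psi> x) y + commutator x (\<psi> y)"
    and offdiag_offdiag: "\<lbrakk>y \<in> offdiag; y' \<in> offdiag\<rbrakk> \<Longrightarrow>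
       \<psi> (commutator y y') = commutator (\<psi> y) y' + commutator y (\<psi> y')"
begin

lemmas lin = module_hom.add[OF hom] module_hom.diff[OF hom] module_hom.neg[OF hom]
  module_hom.zero[OF hom] module_hom.scale[OF hom]

lemma peirce_mult:
  assumes "y \<in> offdiag"
  shows "\<psi> (e * y) = e * \<psi> y" "\<psi> (f * y) = f * \<psi> y"
proof -
  have d: "e * z + e * z = z - s * z" "f * z + f * z = z + s * z" for z
    using e_plus_f_mult(1)[of z] by (simp_all add: s_def ring_distribs algebra_simps)
  show "\<psi> (e * y) = e * \<psi> y"
    by (rule double_cancel) (metis d(1) s_mult[OF assms] lin(1,2))
  show "\<psi> (f * y) = f * \<psi> y"
    by (rule double_cancel) (metis d(2) s_mult[OF assms] lin(1))
qed

lemma complementary_mult: "complementary g h \<Longrightarrow> y \<in> offdiag \<Longrightarrow> \<psi> (g * y) = g * \<psi> y"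
  by (auto simp: complementary_def peirce_mult)

text \<open>
  For odd \<open>y\<close>, the Jacobi identity writes \<open>[[x, x'], y]\<close> through commutators with odd argument, for
  which the Leibniz rule holds. Comparison shows that the defect commutes with \<open>y\<close>.
\<close>

lemma lie_defect_central:
  assumes "x \<in> diag" "x' \<in> diag"
  shows "\<psi> (commutator x x') - commutator (\<psi> x) x' - commutator x (\<psi> x') \<in> centre UNIV"
proof (rule centralI)
  show "\<psi> (commutator x x') - commutator (\<psi> x) x' - commutator x (\<psi> x') \<in> diag"
    using assms by (simp add: diag)
  fix y assume y: "y \<in> offdiag"
  have "commutator (\<psi> (commutator x x')) y
      = \<psi> (commutator (commutator x x') y) - commutator (commutator x x') (\<psi> y)"
    using assms y by (simp add: diag_offdiag)
  also have "\<psi> (commutator (commutator x x') y)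
      = \<psi> (commutator x (commutator x' y)) - \<psi> (commutator x' (commutator x y))"
    by (simp add: jacobi lin)
  finally show "commutator (\<psi> (commutator x x') - commutator (\<psi> x) x' - commutator x (\<psi> x')) y = 0"
    using assms y by (simp add: diag_offdiag jacobi commutator_simps)
qed

text \<open>
  The elements of the corner at \<open>g\<close> whose image returns to that corner after a central correction.
  Such elements form a subalgebra containing all commutators and idempotents of the corner.
\<close>

definition correctable :: "'a \<Rightarrow> 'a set" where
  "correctable g = {a \<in> corner g. \<exists>z \<in> centre UNIV. \<psi> a - z \<in> corner g}"

text \<open>
  The Lie defect serves as the correction. The two other terms of the Leibniz rule lie in the corner,
  which is an ideal of the even part.
\<close>

lemma correctable_commutator:
  assumes "complementary g h" "a \<in> corner g" "a' \<in> corner g"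
  shows "commutator a a' \<in> correctable g"
proof -
  let ?k = "\<psi> (commutator a a') - commutator (\<psi> a) a' - commutator a (\<psi> a')"
  note d = assms(2,3)[THEN corner_diag]
  have c: "commutator x y \<in> corner g" if "x \<in> corner g \<and> y \<in> diag \<or> x \<in> diag \<and> y \<in> corner g" for x y
    using that corner_mult[of _ g] corner_mult(2)[OF assms(1)] corner_closed(2)
    by (auto simp: commutator_def)
  have "\<psi> (commutator a a') - ?k \<in> corner g"
    using c[of "\<psi> a" a'] c[of a "\<psi> a'"] assms(2,3) d diag corner_closed(1) by simp
  moreover have "?k \<in> centre UNIV"
    using lie_defect_central d by blast
  moreover have "commutator a a' \<in> corner g"
    using c[of a a'] assms(2) d by blast
  ultimately show ?thesis
    unfolding correctable_def by blast
qed

text \<open>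
  On odd elements the central summand \<open>z\<close> is invisible, and \<open>\<psi> a\<close> acts through its corner part \<open>b\<close>.
\<close>

lemma correctable_act:
  assumes "complementary g h" "a \<in> corner g" "z \<in> centre UNIV" "b = \<psi> a - z" "b \<in> corner g"
    "y \<in> offdiag"
  shows "g * y = y \<Longrightarrow> \<psi> (a * y) = b * y + a * \<psi> y"
    and "h * y = y \<Longrightarrow> \<psi> (y * a) = \<psi> y * a + y * b"
proof -
  have "\<psi> a = b + z" using assms(4) by simp
  then have "\<psi> (commutator a y) = commutator b y + commutator a (\<psi> y)"
    using diag_offdiag[OF corner_diag[OF assms(2)] assms(6)]
    by (simp add: commutator_simps commutator_central assms(3))
  note D = this
  show "\<psi> (a * y) = b * y + a * \<psi> y" if gy: "g * y = y"
  proof -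
    have "g * \<psi> y = \<psi> y"
      using complementary_mult[OF assms(1,6)] gy by simp
    then show ?thesis
      using D corner_offdiag(3)[OF assms(1,2,6) gy] corner_offdiag(3)[OF assms(1,5,6) gy]
        corner_offdiag(3)[OF assms(1,2) offdiag[OF assms(6)]] by simp
  qed
  show "\<psi> (y * a) = \<psi> y * a + y * b" if gy: "h * y = y"
  proof -
    have "h * \<psi> y = \<psi> y"
      using complementary_mult[OF complementary_sym[OF assms(1)] assms(6)] gy by simp
    then have "- \<psi> (y * a) = - (y * b) - \<psi> y * a"
      using D corner_offdiag(4)[OF assms(1,2,6) gy] corner_offdiag(4)[OF assms(1,5,6) gy]
        corner_offdiag(4)[OF assms(1,2) offdiag[OF assms(6)]] by (simp add: lin)
    from arg_cong[OF this, of uminus] show ?thesis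
      by (simp add: add.commute)
  qed
qed

lemma central_by_peirce:
  assumes "complementary g h" "k \<in> diag"
    and "\<And>y. y \<in> offdiag \<Longrightarrow> g * y = y \<Longrightarrow> commutator k y = 0"
    and "\<And>y. y \<in> offdiag \<Longrightarrow> h * y = y \<Longrightarrow> commutator k y = 0"
  shows "k \<in> centre UNIV"
proof (rule centralI[OF assms(2)])
  fix y assume y: "y \<in> offdiag"
  have "commutator k (g * y) = 0" "commutator k (h * y) = 0"
    using assms(3)[of "g * y"] assms(4)[of "h * y"] y
    by (simp_all add: complementary_simps(5,6,9,10)[OF assms(1)])
  then show "commutator k y = 0"
    using complementary_sum[OF assms(1), of y] by (metis add.right_neutral commutator_simps(2))
qed

text \<open>
  The element \<open>k\<close> of the proof is the candidate for the central correction of \<open>a * a'\<close>. Computing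
  \<open>\<psi> (a * a' * y)\<close> and \<open>\<psi> (y * a * a')\<close> in two ways shows that it is central.
\<close>

lemma correctable_mult:
  assumes "complementary g h" "a \<in> correctable g" "a' \<in> correctable g"
  shows "a * a' \<in> correctable g"
proof -
  obtain z z' where a: "a \<in> corner g" "z \<in> centre UNIV" "\<psi> a - z \<in> corner g"
    and a': "a' \<in> corner g" "z' \<in> centre UNIV" "\<psi> a' - z' \<in> corner g"
    using assms(2,3) by (auto simp: correctable_def)
  define b where "b = \<psi> a - z"
  define b' where "b' = \<psi> a' - z'"
  define k where "k = \<psi> (a * a') - (b * a' + a * b')"
  note act = correctable_act[OF assms(1) a(1,2) b_def a(3)[folded b_def]]
    correctable_act[OF assms(1) a'(1,2) b'_def a'(3)[folded b'_def]]
  have d: "a \<in> diag" "a' \<in> diag" "b \<in> diag" "b' \<in> diag"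
    using a a' corner_diag by (auto simp: b_def b'_def)
  have bc: "b \<in> corner g" "b' \<in> corner g" using a a' by (auto simp: b_def b'_def)
  have aa: "a * a' \<in> corner g" "b * a' + a * b' \<in> corner g"
    using a a' d bc corner_mult(1) corner_closed(1) by auto
  have "k \<in> centre UNIV"
  proof (rule central_by_peirce[OF assms(1)])
    show "k \<in> diag" using d by (simp add: k_def diag)
    fix y assume y: "y \<in> offdiag"
    have D: "\<psi> (commutator (a * a') y) = commutator (\<psi> (a * a')) y + commutator (a * a') (\<psi> y)"
      using d y by (simp add: diag_offdiag)
    { assume gy: "g * y = y"
      then have gpsi: "g * \<psi> y = \<psi> y" using complementary_mult[OF assms(1) y] by simp
      have "g * (a' * y) = a' * y" using gy d(2) complementary_simps(12)[OF assms(1)] by metis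
      then have "\<psi> (a * (a' * y)) = b * (a' * y) + a * (b' * y + a' * \<psi> y)"
        using act(1)[of "a' * y"] act(3)[OF y gy] d y by simp
      with D show "commutator k y = 0"
        using corner_offdiag(3)[OF assms(1) aa(1) y gy]
          corner_offdiag(3)[OF assms(1) aa(1) offdiag[OF y] gpsi]
          corner_offdiag(3)[OF assms(1) aa(2) y gy]
        by (simp add: k_def commutator_simps ring_distribs mult.assoc) }
    { assume gy: "h * y = y"
      then have gpsi: "h * \<psi> y = \<psi> y" using complementary_mult[OF complementary_sym[OF assms(1)] y]
        by simp
      have "h * (y * a) = y * a" using gy by (simp flip: mult.assoc)
      then have "\<psi> (y * a * a') = (\<psi> y * a + y * b) * a' + y * a * b'"
        using act(4)[of "y * a"] act(2)[OF y gy] d y by simp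
      moreover have "- \<psi> (y * (a * a')) = commutator (\<psi> (a * a')) y - \<psi> y * (a * a')"
        using D unfolding corner_offdiag(4)[OF assms(1) aa(1) y gy]
          corner_offdiag(4)[OF assms(1) aa(1) offdiag[OF y] gpsi] by (simp add: lin)
      ultimately have "commutator (\<psi> (a * a')) y = - (y * (b * a' + a * b'))"
        by (simp add: mult.assoc ring_distribs algebra_simps)
      then show "commutator k y = 0"
        unfolding k_def commutator_simps(3) corner_offdiag(4)[OF assms(1) aa(2) y gy] by simp }
  qed
  moreover have "\<psi> (a * a') - k \<in> corner g"
  proof -
    have "\<psi> (a * a') - k = b * a' + a * b'" by (simp add: k_def)
    then show ?thesis using aa(2) by simp
  qed
  ultimately show ?thesis using aa(1) unfolding correctable_def by blast
qed

text \<open>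
  Write \<open>k = \<psi> p\<close>. On either odd block, commutation with \<open>p\<close> is an idempotent operator \<open>P\<close> up to
  sign. If \<open>K\<close> denotes commutation with \<open>k\<close>, applying \<open>\<psi>\<close> to \<open>P (P y) = \<plusminus> P y\<close> gives
  \<open>K P + P K = \<plusminus> K\<close>, hence \<open>P K P = 0\<close>. So \<open>K\<close> agrees with commutation with \<open>[[k, p], p]\<close> on odd
  elements, and \<open>k - [[k, p], p]\<close> is central. The double commutator lies in the corner of \<open>p\<close>.
\<close>

lemma correctable_idem:
  assumes "complementary g h" "p \<in> corner g" "p * p = p"
  shows "p \<in> correctable g"
proof -
  define k where "k = \<psi> p"
  define c where "c = commutator (commutator k p) p"
  have p: "p \<in> diag" and k: "k \<in> diag" using assms(2) diag corner_diag by (auto simp: k_def)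
  have pp: "p * (p * x) = p * x" for x using assms(3) by (simp flip: mult.assoc)
  have c_eq: "c = k * p - (p * (k * p) + p * (k * p)) + p * k"
    using assms(3) by (simp add: c_def commutator_def ring_distribs mult.assoc pp algebra_simps)
  have c: "c \<in> corner g"
    unfolding c_eq using corner_mult(1)[OF assms(2)] corner_mult(2)[OF assms(1,2) k] k p
    by (intro corner_closed) auto
  have "k - c \<in> centre UNIV"
  proof (rule central_by_peirce[OF assms(1)])
    show "k - c \<in> diag" using k c corner_diag by simp
    fix y assume y: "y \<in> offdiag"
    have D: "\<psi> (commutator p y) = commutator k y + commutator p (\<psi> y)" if "y \<in> offdiag" for y
      using p that by (simp add: diag_offdiag k_def)
    { assume gy: "g * y = y"
      then have gpsi: "g * \<psi> y = \<psi> y" using complementary_mult[OF assms(1) y] by simp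
      \<comment> \<open>the block on which \<open>p\<close> acts from the left\<close>
      have gp: "g * (p * y) = p * y" using gy p complementary_simps(12)[OF assms(1)] by metis
      have gp': "g * \<psi> (p * y) = \<psi> (p * y)" using complementary_mult[OF assms(1), of "p * y"] p y gp
        by simp
      have 1: "\<psi> (p * y) = commutator k y + p * \<psi> y"
        using D[OF y] corner_offdiag(3)[OF assms(1,2) y gy]
          corner_offdiag(3)[OF assms(1,2) offdiag[OF y] gpsi]
        by simp
      have "\<psi> (p * (p * y)) = commutator k (p * y) + p * \<psi> (p * y)"
        using D[of "p * y"] p y corner_offdiag(3)[OF assms(1,2) _ gp]
          corner_offdiag(3)[OF assms(1,2) offdiag gp']
        by simp
      then have 2: "commutator k y = commutator k (p * y) + p * commutator k y"
        unfolding pp 1 by (simp add: ring_distribs pp)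
      have "p * commutator k y = p * commutator k (p * y) + p * (p * commutator k y)"
        using 2 by (metis distrib_left)
      then have "p * commutator k (p * y) = 0"
        unfolding pp by simp
      then have 3: "p * (k * (p * y)) = p * (y * k)"
        by (simp add: commutator_def ring_distribs pp mult.assoc)
      have "commutator c y = c * y"
        using corner_offdiag(3)[OF assms(1) c y gy] .
      also have "\<dots> = commutator k (p * y) + p * commutator k y"
        by (simp add: c_eq commutator_def ring_distribs mult.assoc 3 algebra_simps)
      finally show "commutator (k - c) y = 0" using 2 by (simp add: commutator_simps) }
    { assume gy: "h * y = y"
      then have gpsi: "h * \<psi> y = \<psi> y" using complementary_mult[OF complementary_sym[OF assms(1)] y]
        by simp
      \<comment> \<open>the block on which \<open>p\<close> acts from the right\<close>
      have gp: "h * (y * p) = y * p" using gy by (simp flip: mult.assoc)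
      have gp': "h * \<psi> (y * p) = \<psi> (y * p)"
        using complementary_mult[OF complementary_sym[OF assms(1)], of "y * p"] p y gp by simp
      have 1: "\<psi> (y * p) = \<psi> y * p - commutator k y"
        using arg_cong[OF D[OF y], of uminus] corner_offdiag(4)[OF assms(1,2) y gy]
          corner_offdiag(4)[OF assms(1,2) offdiag[OF y] gpsi]
        by (simp add: lin)
      have "\<psi> (y * p * p) = \<psi> (y * p) * p - commutator k (y * p)"
        using arg_cong[OF D[of "y * p"], of uminus] p y corner_offdiag(4)[OF assms(1,2) _ gp]
          corner_offdiag(4)[OF assms(1,2) offdiag gp']
        by (simp add: lin)
      then have 2: "commutator k y = commutator k (y * p) + commutator k y * p"
        unfolding mult.assoc assms(3) 1
          by (simp add: ring_distribs mult.assoc assms(3) algebra_simps)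
      have "commutator k y * p = commutator k (y * p) * p + commutator k y * p * p"
        using 2 by (metis distrib_right)
      then have "commutator k (y * p) * p = 0"
        unfolding mult.assoc assms(3) by simp
      then have 3: "y * (p * (k * p)) = k * (y * p)"
        by (simp add: commutator_def ring_distribs assms(3) mult.assoc)
      have "commutator c y = - (y * c)"
        using corner_offdiag(4)[OF assms(1) c y gy] .
      also have "\<dots> = commutator k (y * p) + commutator k y * p"
        by (simp add: c_eq commutator_def ring_distribs mult.assoc 3 algebra_simps)
      finally show "commutator (k - c) y = 0" using 2 by (simp add: commutator_simps) }
  qed
  moreover have "\<psi> p - (k - c) \<in> corner g" using c by (simp add: k_def)
  ultimately show ?thesis using assms(2) unfolding correctable_def by blast
qed

lemma correctable_subspace:
  assumes "complementary g h"
  shows "subspace (correctable g)"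
  unfolding subspace_def
proof (intro conjI ballI allI)
  show "0 \<in> correctable g" by (auto simp: correctable_def corner_closed lin intro!: bexI[of _ 0])
  fix a b assume "a \<in> correctable g" "b \<in> correctable g"
  then obtain z w where "a \<in> corner g" "b \<in> corner g" "z \<in> centre UNIV" "w \<in> centre UNIV"
    "\<psi> a - z \<in> corner g" "\<psi> b - w \<in> corner g" by (auto simp: correctable_def)
  then have "a + b \<in> corner g" "z + w \<in> centre UNIV" "\<psi> (a + b) - (z + w) \<in> corner g"
    using corner_closed(1)[of "\<psi> a - z" g "\<psi> b - w"] corner_closed(1)[of a g b]
    by (simp_all add: lin algebra_simps)
  then show "a + b \<in> correctable g" unfolding correctable_def by blast
next
  fix r a assume "a \<in> correctable g"
  then obtain z where "a \<in> corner g" "z \<in> centre UNIV" "\<psi> a - z \<in> corner g"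
    by (auto simp: correctable_def)
  then have "scale r a \<in> corner g" "scale r z \<in> centre UNIV" "\<psi> (scale r a) - scale r z \<in> corner g"
    using corner_scale[OF assms, of "\<psi> a - z" r] corner_scale[OF assms, of a r]
    by (simp_all add: lin scale_right_diff_distrib)
  then show "scale r a \<in> correctable g" unfolding correctable_def by blast
qed

lemma correctable_idem_comm_subalgebra:
  assumes "complementary g h" "corner g = idem_comm_subalgebra scale (corner g)"
  shows "corner g \<subseteq> correctable g"
proof -
  have "subalgebra scale (correctable g) (corner g)"
    using correctable_subspace[OF assms(1)] correctable_mult[OF assms(1)]
      by (auto simp: subalgebra_def correctable_def)
  then have "idem_comm_subalgebra scale (corner g) \<subseteq> correctable g"
    using correctable_idem[OF assms(1)] correctable_commutator[OF assms(1)]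
    unfolding idem_comm_subalgebra_def by blast
  then show ?thesis using assms(2) by simp
qed

text \<open>
  Opposite corners commute, so this is the negative of the defect of \<open>[a, b] = 0\<close>.
\<close>

lemma cross_defect_central:
  assumes "complementary g h" "a \<in> corner g" "b \<in> corner h"
  shows "commutator (\<psi> a) b + commutator a (\<psi> b) \<in> centre UNIV"
proof -
  have "commutator a b = 0" using corner_annihilate[OF assms] by (simp add: commutator_def)
  then have "commutator (\<psi> a) b + commutator a (\<psi> b)
      = - (\<psi> (commutator a b) - commutator (\<psi> a) b - commutator a (\<psi> b))"
    by (simp add: lin add.commute)
  then show ?thesis
    using central_closed(4)[OF lie_defect_central[OF corner_diag corner_diag, OF assms(2,3)]]
      by metis
qed

text \<open>
  The component of \<open>\<psi> b\<close> in the other corner is central there, and by assumption it extends to a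
  central element of the whole algebra. This extension is the correction.
\<close>

lemma correctable_if_commutes:
  assumes "complementary g h" "centre (corner g) = sandwich g (centre UNIV) g" "b \<in> corner h"
    and "\<And>a. a \<in> corner g \<Longrightarrow> commutator a (\<psi> b) = 0"
  shows "b \<in> correctable h"
proof -
  have d: "\<psi> b \<in> diag" using assms(3) diag corner_diag by blast
  have "g * \<psi> b \<in> centre (corner g)"
    unfolding centre_def
  proof (intro CollectI conjI ballI)
    show "g * \<psi> b \<in> corner g" using d
      by (simp add: corner_def complementary_simps(5,9)[OF assms(1)])
    fix a assume a: "a \<in> corner g"
    have "a * (g * \<psi> b) = g * (a * \<psi> b)"
      using complementary_simps(12)[OF assms(1) corner_diag[OF a]] .
    then show "g * \<psi> b * a = a * (g * \<psi> b)"
      using assms(4)[OF a] by (simp add: commutator_def mult.assoc)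
  qed
  then obtain z where z: "z \<in> centre UNIV" "g * \<psi> b = g * z * g"
    using assms(2) by (auto simp: sandwich_def)
  then have "g * (\<psi> b - z) = 0"
    using central_diag[OF z(1)] by (simp add: ring_distribs mult.assoc complementary_simps[OF
      assms(1)])
  then have "\<psi> b - z \<in> corner h"
    using corner_iff[OF complementary_sym[OF assms(1)]] d central_diag[OF z(1)] by simp
  then show ?thesis using assms(3) z(1) by (auto simp: correctable_def)
qed

lemma central_corner_zero: "complementary g h \<Longrightarrow> z \<in> centre UNIV \<Longrightarrow> z \<in> corner g \<Longrightarrow> z = 0"
  using central_zero[of z h] corner_iff[of g h z] by (auto simp: complementary_def)

lemma commutator_corner:
  assumes "complementary g h" "a \<in> corner g" "x \<in> diag"
  shows "commutator a x \<in> corner g" "commutator x a \<in> corner g"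
  unfolding commutator_def
  by (simp_all add: corner_closed(2) corner_mult(1)[OF assms(2,3)] corner_mult(2)[OF assms])

text \<open>
  If \<open>\<psi> a\<close> is corrected to an element of the corner at \<open>g\<close>, it commutes with the corner at \<open>h\<close>. The
  central element \<open>[\<psi> a, b] + [a, \<psi> b]\<close> thus reduces to \<open>[a, \<psi> b]\<close>, which lies in a corner and
  hence vanishes.
\<close>

lemma correctable_complementary:
  assumes "complementary g h" "corner g \<subseteq> correctable g"
    "centre (corner g) = sandwich g (centre UNIV) g"
  shows "corner h \<subseteq> correctable h"
proof
  fix b assume b: "b \<in> corner h"
  show "b \<in> correctable h"
  proof (rule correctable_if_commutes[OF assms(1,3) b])
    fix a assume a: "a \<in> corner g"
    then obtain z where z: "z \<in> centre UNIV" "\<psi> a - z \<in> corner g"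
      using assms(2) by (auto simp: correctable_def)
    have "commutator (\<psi> a - z) b = 0"
      using corner_annihilate[OF assms(1) z(2) b] by (simp add: commutator_def)
    then have "commutator (\<psi> a) b = 0"
      using z(1) by (simp add: commutator_simps commutator_central)
    then have "commutator a (\<psi> b) \<in> centre UNIV"
      using cross_defect_central[OF assms(1) a b] by simp
    then show "commutator a (\<psi> b) = 0"
      using central_corner_zero[OF assms(1)] commutator_corner(1)[OF assms(1) a] diag
        corner_diag[OF b]
      by blast
  qed
qed

text \<open>
  The two summands lie in different corners, so both of them vanish.
\<close>

lemma correctable_of_cross_zero:
  assumes "complementary g h" "centre (corner g) = sandwich g (centre UNIV) g"
    "centre (corner h) = sandwich h (centre UNIV) h"
    and z: "\<And>a b. \<lbrakk>a \<in> corner g; b \<in> corner h\<rbrakk> \<Longrightarrow> commutator (\<psi> a) b + commutator a (\<psi> b) = 0"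
  shows "corner g \<subseteq> correctable g" "corner h \<subseteq> correctable h"
proof -
  have *: "commutator a (\<psi> b) = 0 \<and> commutator b (\<psi> a) = 0" if "a \<in> corner g" "b \<in> corner h" for a b
  proof -
    have 1: "commutator a (\<psi> b) \<in> corner g" "commutator (\<psi> a) b \<in> corner h"
      using commutator_corner(1)[OF assms(1) that(1) diag[OF corner_diag[OF that(2)]]]
        commutator_corner(2)[OF complementary_sym[OF assms(1)] that(2) diag[OF corner_diag[OF
          that(1)]]] .
    have "h * commutator a (\<psi> b) = 0"
      using 1(1) corner_iff[OF assms(1)] by blast
    moreover have "h * commutator (\<psi> a) b = commutator (\<psi> a) b"
      using 1(2) by (simp add: corner_def)
    ultimately have "commutator (\<psi> a) b = h * (commutator (\<psi> a) b + commutator a (\<psi> b))"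
      by (simp add: distrib_left)
    then have "commutator (\<psi> a) b = 0" using z[OF that] by simp
    then show ?thesis using z[OF that] by (simp add: commutator_def)
  qed
  then show "corner g \<subseteq> correctable g" "corner h \<subseteq> correctable h"
    using correctable_if_commutes[OF assms(1,2)]
      correctable_if_commutes[OF complementary_sym[OF assms(1)] assms(3)] by auto
qed

text \<open>
  The component of \<open>[\<psi> a, b] + [a, \<psi> b]\<close> at \<open>g\<close> is \<open>[a, \<psi> b]\<close>. It is central in the corner,
  so property (P) makes \<open>g * \<psi> b\<close> central in the corner and \<open>[a, \<psi> b] = 0\<close>.
\<close>

lemma correctable_of_property_P:
  assumes "complementary g h" "centre (corner g) = sandwich g (centre UNIV) g"
    "centre (corner h) = sandwich h (centre UNIV) h" "property_P (corner g)"
  shows "corner g \<subseteq> correctable g" "corner h \<subseteq> correctable h"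
proof -
  have *: "commutator (\<psi> a) b + commutator a (\<psi> b) = 0"
    if a: "a \<in> corner g" and b: "b \<in> corner h" for a b
  proof -
    have d: "\<psi> b \<in> diag" using b diag corner_diag by blast
    have gb: "g * \<psi> b \<in> corner g" using d
      by (simp add: corner_def complementary_simps(5,9)[OF assms(1)])
    have eq: "commutator (g * \<psi> b) a = - commutator a (\<psi> b)" if "a \<in> corner g" for a
    proof -
      have "g * (\<psi> b * a) = \<psi> b * a" "g * (a * \<psi> b) = a * \<psi> b"
        using corner_mult(1)[OF that d] corner_mult(2)[OF assms(1) that d]
        by (simp_all add: corner_def)
      then show ?thesis
        using complementary_simps(12)[OF assms(1) corner_diag[OF that]]
          by (simp add: commutator_def mult.assoc)
    qed
    have "commutator (g * \<psi> b) ` corner g \<subseteq> centre (corner g)"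
    proof clarify
      fix a assume a: "a \<in> corner g"
      let ?c = "commutator (\<psi> a) b + commutator a (\<psi> b)"
      have c: "?c \<in> centre UNIV" by (rule cross_defect_central[OF assms(1) a b])
      have 1: "commutator a (\<psi> b) \<in> corner g" "commutator (\<psi> a) b \<in> corner h"
        using commutator_corner(1)[OF assms(1) a diag[OF corner_diag[OF b]]]
          commutator_corner(2)[OF complementary_sym[OF assms(1)] b diag[OF corner_diag[OF a]]] .
      have "g * commutator (\<psi> a) b = 0"
        using 1(2) corner_iff[OF complementary_sym[OF assms(1)]] by blast
      moreover have "g * commutator a (\<psi> b) = commutator a (\<psi> b)"
        using 1(1) by (simp add: corner_def)
      ultimately have "g * ?c = commutator a (\<psi> b)"
        by (simp add: distrib_left)
      moreover have "g * ?c = g * ?c * g"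
        using central_diag[OF c] by (simp add: mult.assoc complementary_simps[OF assms(1)])
      ultimately have "- commutator a (\<psi> b) = g * (- ?c) * g"
        by (simp only: mult_minus_left mult_minus_right)
      then have "- commutator a (\<psi> b) \<in> sandwich g (centre UNIV) g"
        using c central_closed(4) unfolding sandwich_def by blast
      then show "commutator (g * \<psi> b) a \<in> centre (corner g)"
        using eq[OF a] assms(2) by simp
    qed
    then have "g * \<psi> b \<in> centre (corner g)"
      using assms(4) gb unfolding property_P_def by blast
    then have "commutator a (\<psi> b) = 0"
      using eq[OF a] a by (simp add: centre_def commutator_def)
    moreover from this have "commutator (\<psi> a) b \<in> centre UNIV"
      using cross_defect_central[OF assms(1) a b] by simp
    then have "commutator (\<psi> a) b = 0"
      by (rule central_corner_zero[OF complementary_sym[OF assms(1)] _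
            commutator_corner(2)[OF complementary_sym[OF assms(1)] b diag[OF corner_diag[OF a]]]])
    ultimately show ?thesis by simp
  qed
  show "corner g \<subseteq> correctable g" "corner h \<subseteq> correctable h"
    by (rule correctable_of_cross_zero[OF assms(1-3) *]; assumption)+
qed

end

section \<open>From a graded Lie map to a derivation\<close>

context peirce
begin

lemma corner_sandwich_id: "complementary g h \<Longrightarrow> x \<in> corner g \<Longrightarrow> g * x * g = x"
  using complementary_simps(11)[of g h x] by (simp add: corner_def)

lemma sandwich_central_diag: "complementary g h \<Longrightarrow> z \<in> diag \<Longrightarrow> g * z * g = g * z"
  by (simp add: complementary_simps mult.assoc)

lemma central_sandwich:
  "complementary g h \<Longrightarrow> z \<in> centre UNIV \<Longrightarrow> g * z \<in> sandwich g (centre UNIV) g"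
  using sandwich_central_diag[of g h z] central_diag[of z] unfolding sandwich_def by force

lemma central_corner: "complementary g h \<Longrightarrow> z \<in> centre UNIV \<Longrightarrow> g * z \<in> centre (corner g)"
proof -
  assume g: "complementary g h" and z: "z \<in> centre UNIV"
  have "g * z \<in> corner g"
    using central_diag[OF z] by (simp add: corner_def complementary_simps(5,9)[OF g])
  moreover have "g * z * x = x * (g * z)" if "x \<in> corner g" for x
    using complementary_simps(12)[OF g corner_diag[OF that]] central_commute[OF z, of x]
      by (simp add: mult.assoc)
  ultimately show "g * z \<in> centre (corner g)"
    by (simp add: centre_def)
qed

text \<open>
  Since \<open>c\<close> is central in the corner \<open>C\<close>, the set \<open>C * c\<close> is already an ideal, and by
  assumption it is central.
\<close>

lemma principal_central_ideal:
  assumes "complementary g h" and no: "\<And>I. central_ideal scale I (corner g) \<Longrightarrow> I = {0}"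
    and c: "c \<in> corner g" "\<And>a. a \<in> corner g \<Longrightarrow> a * c \<in> centre (corner g)"
  shows "c = 0"
proof -
  let ?I = "{a * c | a. a \<in> corner g}"
  have sub: "?I \<subseteq> centre (corner g)" using c(2) by auto
  have left: "b * x \<in> ?I" if "x \<in> ?I" "b \<in> corner g" for x b
    using that corner_mult(1)[OF that(2) corner_diag] by (auto simp: mult.assoc[symmetric])
  have right: "x * b \<in> ?I" if "x \<in> ?I" "b \<in> corner g" for x b
  proof -
    have "x \<in> centre (corner g)" using sub that(1) by blast
    then have "x * b = b * x" using that(2) by (simp add: centre_def)
    then show ?thesis using left[OF that] by simp
  qed
  have "\<forall>x\<in>?I. \<forall>b\<in>corner g. b * x \<in> ?I \<and> x * b \<in> ?I"
    using left right by blast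
  moreover have "subspace ?I"
    unfolding subspace_def
  proof (intro conjI ballI allI)
    show "0 \<in> ?I" using corner_closed(3) by force
    fix x y assume "x \<in> ?I" "y \<in> ?I"
    then obtain a b where "a \<in> corner g" "b \<in> corner g" "x = a * c" "y = b * c" by auto
    then show "x + y \<in> ?I"
      by (auto simp: distrib_right[symmetric] corner_closed intro!: exI[of _ "a + b"])
  next
    fix r x assume "x \<in> ?I"
    then obtain a where "a \<in> corner g" "x = a * c" by auto
    then show "scale r x \<in> ?I"
      using corner_scale[OF assms(1)] by (auto simp: scale_mult_left intro!: exI[of _ "scale r a"])
  qed
  ultimately have "central_ideal scale ?I (corner g)"
    using sub by (auto simp: central_ideal_def algebra_ideal_def centre_def)
  then have "?I = {0}" by (rule no)
  moreover have "g * c \<in> ?I"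
    using complementary_simps(1,9)[OF assms(1)] by (auto simp: corner_def)
  ultimately show "c = 0" using c(1) by (simp add: corner_def)
qed

text \<open>
  Multiplication by \<open>s\<close> turns commutators of an even with an odd element into Jordan products. Therefore a
  rule for commutators that is compatible with \<open>s\<close> yields one for Jordan products, and by
  \<open>double_mult\<close> one for products.
\<close>

lemma jordan_s: "x \<in> diag \<Longrightarrow> y \<in> offdiag \<Longrightarrow> commutator (s * x) y = s * (x * y + y * x)"
  by (simp add: commutator_def graded ring_distribs mult.assoc)

lemma double_mult:
  "x * y + x * y = commutator x y + (x * y + y * x)"
  "y * x + y * x = (x * y + y * x) - commutator x y" for x y :: 'a
  by (simp_all add: commutator_def algebra_simps)

end

locale proper_graded_lie_map = graded_lie_map scale e f \<psi>
  for scale :: "'r::comm_ring_1 \<Rightarrow> 'a::ring_1 \<Rightarrow> 'a" and e f :: 'a and \<psi> :: "'a \<Rightarrow> 'a" +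
  assumes correctable_e: "corner e \<subseteq> correctable e" and correctable_f: "corner f \<subseteq> correctable f"
begin

text \<open>
  The central correction is unique: the difference of two of them is central and lies in a corner.
\<close>

definition correction :: "'a \<Rightarrow> 'a \<Rightarrow> 'a" where
  "correction g x = (THE z. z \<in> centre UNIV \<and> \<psi> (g * x * g) - z \<in> corner g)"

lemma correction_unique:
  assumes "complementary g h" "z \<in> centre UNIV" "\<psi> (g * x * g) - z \<in> corner g"
  shows "correction g x = z"
  unfolding correction_def
proof (rule the_equality)
  fix w assume w: "w \<in> centre UNIV \<and> \<psi> (g * x * g) - w \<in> corner g"
  have "z - w = (\<psi> (g * x * g) - w) - (\<psi> (g * x * g) - z)" by simp
  also have "\<dots> \<in> corner g" using corner_closed(2) w assms(3) by blast
  finally have "z - w = 0"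
    by (rule central_corner_zero[OF assms(1), rotated]) (use w assms(2) in simp)
  then show "w = z" by simp
qed (use assms in simp)

lemma correction:
  assumes "complementary g h"
  shows "correction g x \<in> centre UNIV" "\<psi> (g * x * g) - correction g x \<in> corner g"
proof -
  have "g * x * g \<in> corner g"
    using sandwich_corner[OF assms] by (auto simp: sandwich_def)
  then have "g * x * g \<in> correctable g" using correctable_e correctable_f assms
    by (auto simp: complementary_def)
  then obtain z where z: "z \<in> centre UNIV" "\<psi> (g * x * g) - z \<in> corner g"
    by (auto simp: correctable_def)
  then show "correction g x \<in> centre UNIV" "\<psi> (g * x * g) - correction g x \<in> corner g"
    using correction_unique[OF assms z] by simp_all
qed

lemma correction_linear:
  assumes "complementary g h"
  shows "correction g (x + y) = correction g x + correction g y"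
    "correction g (scale r x) = scale r (correction g x)"
proof -
  have "\<psi> (g * (x + y) * g) - (correction g x + correction g y)
      = (\<psi> (g * x * g) - correction g x) + (\<psi> (g * y * g) - correction g y)"
    by (simp add: ring_distribs lin)
  also have "\<dots> \<in> corner g" using correction(2)[OF assms] corner_closed(1) by blast
  finally show "correction g (x + y) = correction g x + correction g y"
    using correction_unique[OF assms] correction(1)[OF assms] by simp
  have "\<psi> (g * scale r x * g) - scale r (correction g x) = scale r (\<psi> (g * x * g) - correction g x)"
    by (simp add: lin scale_mult_left[symmetric] scale_mult_right[symmetric]
      scale_right_diff_distrib)
  also have "\<dots> \<in> corner g" using correction(2)[OF assms] corner_scale[OF assms] by blast
  finally show "correction g (scale r x) = scale r (correction g x)"
    using correction_unique[OF assms] correction(1)[OF assms] by simp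
qed

lemma correction_zero: "complementary g h \<Longrightarrow> g * x * g = 0 \<Longrightarrow> correction g x = 0"
  by (rule correction_unique) (simp_all add: lin corner_closed)

definition gamma :: "'a \<Rightarrow> 'a" where "gamma x = correction e x + correction f x"
definition der :: "'a \<Rightarrow> 'a" where "der x = \<psi> x - gamma x"

lemma gamma_hom: "module_hom scale scale gamma"
  by (auto simp: module_hom_iff module_axioms gamma_def correction_linear[OF complementary_ef(1)]
    correction_linear[OF complementary_ef(2)]
      scale_right_distrib)

lemma gamma_central: "gamma x \<in> centre UNIV"
  by (simp add: gamma_def correction[OF complementary_ef(1)] correction[OF complementary_ef(2)])

lemma der_hom: "module_hom scale scale der"
  using module_hom.add[OF gamma_hom] module_hom.scale[OF gamma_hom]
  by (simp add: module_hom_iff module_axioms der_def lin scale_right_diff_distrib)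

lemmas der_lin = module_hom.add[OF der_hom] module_hom.diff[OF der_hom] module_hom.neg[OF der_hom]
  module_hom.zero[OF der_hom] module_hom.scale[OF der_hom]

lemma gamma_corner: "complementary g h \<Longrightarrow> x \<in> corner g \<Longrightarrow> gamma x = correction g x"
proof -
  assume a: "complementary g h" "x \<in> corner g"
  then have "h * x * h = 0" by (simp add: corner_iff)
  then have "correction h x = 0" using correction_zero[OF complementary_sym[OF a(1)]] by simp
  then show ?thesis using a(1) by (auto simp: gamma_def complementary_def)
qed

lemma der_corner: "complementary g h \<Longrightarrow> x \<in> corner g \<Longrightarrow> der x \<in> corner g"
  using correction(2)[of g h x] by (simp add: der_def gamma_corner corner_sandwich_id)

lemma gamma_offdiag: "y \<in> offdiag \<Longrightarrow> gamma y = 0"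
  by (simp add: gamma_def correction_zero[OF complementary_ef(1)] correction_zero[OF
    complementary_ef(2)] graded mult.assoc)

lemma der_offdiag: "y \<in> offdiag \<Longrightarrow> der y = \<psi> y"
  by (simp add: der_def gamma_offdiag)

lemma der_grading: "x \<in> diag \<Longrightarrow> der x \<in> diag" "y \<in> offdiag \<Longrightarrow> der y \<in> offdiag"
  using diag central_diag[OF gamma_central] offdiag
    by (simp_all add: der_offdiag) (simp add: der_def)

text \<open>
  The map \<open>der\<close> preserves both corners, and \<open>s\<close> acts on them as \<open>-1\<close> and \<open>1\<close>.
\<close>

lemma der_s:
  "x \<in> diag \<Longrightarrow> der (s * x) = s * der x"
  "y \<in> offdiag \<Longrightarrow> der (s * y) = s * der y"
proof -
  assume x: "x \<in> diag"
  have c: "e * x \<in> corner e" "f * x \<in> corner f" using x by (simp_all add: corner_def)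
  have 0: "e * der (e * x) = der (e * x)" "f * der (f * x) = der (f * x)"
    using der_corner[OF complementary_ef(1) c(1)] der_corner[OF complementary_ef(2) c(2)]
      by (simp_all add: corner_def)
  have 1: "s * der (e * x) = - der (e * x)" "s * der (f * x) = der (f * x)"
    using s_simps(9)[of "der (e * x)"] s_simps(10)[of "der (f * x)"] unfolding 0 .
  have "s * der x = s * der (e * x) + s * der (f * x)"
    using e_plus_f_mult(1)[of x] by (metis der_lin(1) distrib_left)
  also have "\<dots> = der (f * x - e * x)" by (simp add: 1 der_lin)
  also have "f * x - e * x = s * x" by (simp add: s_def left_diff_distrib)
  finally show "der (s * x) = s * der x" by simp
next
  assume "y \<in> offdiag"
  then show "der (s * y) = s * der y" by (simp add: der_offdiag s_mult)
qed

lemma der_commutator: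
  assumes "x \<in> diag" "y \<in> offdiag"
  shows "der (commutator x y) = commutator (der x) y + commutator x (der y)"
proof -
  have "commutator (gamma x) y = 0" by (rule commutator_central(2)[OF gamma_central])
  then show ?thesis using assms by (simp add: der_offdiag diag_offdiag)
    (simp add: der_def commutator_simps)
qed

lemma der_jordan:
  assumes "x \<in> diag" "y \<in> offdiag"
  shows "der (x * y + y * x) = der x * y + y * der x + (x * der y + der y * x)"
proof -
  have "s * der (x * y + y * x) = der (commutator (s * x) y)"
    unfolding jordan_s[OF assms] by (rule der_s(2)[symmetric]) (use assms in simp)
  also have "\<dots> = commutator (s * der x) y + commutator (s * x) (der y)"
    using assms by (simp add: der_commutator der_s)
  also have "\<dots> = s * (der x * y + y * der x + (x * der y + der y * x))"
    using assms by (simp add: jordan_s der_grading distrib_left)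
  finally show ?thesis by (simp add: s_cancel)
qed

lemma der_diag_offdiag:
  assumes "x \<in> diag" "y \<in> offdiag"
  shows "der (x * y) = der x * y + x * der y" "der (y * x) = der y * x + y * der x"
proof -
  show "der (x * y) = der x * y + x * der y"
  proof (rule double_cancel)
    have "der (x * y) + der (x * y) = der (commutator x y) + der (x * y + y * x)"
      unfolding der_lin(1)[symmetric] double_mult(1) ..
    then show "der (x * y) + der (x * y) = der x * y + x * der y + (der x * y + x * der y)"
      unfolding der_commutator[OF assms] der_jordan[OF assms] by (simp add: commutator_def)
  qed
  show "der (y * x) = der y * x + y * der x"
  proof (rule double_cancel)
    have "der (y * x) + der (y * x) = der (x * y + y * x) - der (commutator x y)"
      unfolding der_lin(1,2)[symmetric] double_mult(2) ..
    then show "der (y * x) + der (y * x) = der y * x + y * der x + (der y * x + y * der x)"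
      unfolding der_commutator[OF assms] der_jordan[OF assms] by (simp add: commutator_def)
  qed
qed

text \<open>
  The element \<open>x * x' * y\<close> is differentiated in two ways, and faithfulness cancels the odd \<open>y\<close>.
\<close>

lemma der_diag_diag:
  assumes "x \<in> diag" "x' \<in> diag"
  shows "der (x * x') = der x * x' + x * der x'"
proof -
  have "der (x * x') - (der x * x' + x * der x') = 0"
  proof (rule faithful_diag)
    fix y assume y: "y \<in> offdiag"
    have "der (x * x') * y + x * x' * der y = der (x * x' * y)"
      using assms y by (simp add: der_diag_offdiag)
    also have "\<dots> = der x * (x' * y) + x * (der x' * y + x' * der y)"
      using assms y by (simp add: der_diag_offdiag mult.assoc)
    finally show "(der (x * x') - (der x * x' + x * der x')) * y = 0"
      by (simp add: ring_distribs mult.assoc)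
    have "der y * (x * x') + y * der (x * x') = der (y * (x * x'))"
      using assms y by (simp add: der_diag_offdiag)
    also have "\<dots> = der (y * x * x')" by (simp add: mult.assoc)
    also have "\<dots> = (der y * x + y * der x) * x' + y * x * der x'"
      using assms y by (simp only: der_diag_offdiag graded_mult)
    finally show "y * (der (x * x') - (der x * x' + x * der x')) = 0"
      by (simp add: ring_distribs mult.assoc)
  qed (use assms in \<open>simp add: der_grading\<close>)
  then show ?thesis by simp
qed

text \<open>
  On odd arguments this is the only remaining obstruction to \<open>der\<close> being a derivation.
\<close>

definition leibniz_defect :: "'a \<Rightarrow> 'a \<Rightarrow> 'a" where
  "leibniz_defect y y' = der (y * y') - (der y * y' + y * der y')"

lemma leibniz_defect_add: "leibniz_defect (y + y') z = leibniz_defect y z + leibniz_defect y' z"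
  "leibniz_defect z (y + y') = leibniz_defect z y + leibniz_defect z y'"
  by (simp_all add: leibniz_defect_def der_lin ring_distribs)

lemma leibniz_defect_zero: "leibniz_defect 0 z = 0" "leibniz_defect z 0 = 0"
  by (simp_all add: leibniz_defect_def der_lin)

lemma leibniz_defect_diag: "y \<in> offdiag \<Longrightarrow> y' \<in> offdiag \<Longrightarrow> leibniz_defect y y' \<in> diag"
  by (simp add: leibniz_defect_def der_grading)

lemma leibniz_defect_module:
  assumes "x \<in> diag" "y \<in> offdiag" "y' \<in> offdiag"
  shows "leibniz_defect (x * y) y' = x * leibniz_defect y y'"
    "leibniz_defect y (y' * x) = leibniz_defect y y' * x"
    "leibniz_defect (y * x) y' = leibniz_defect y (x * y')"
proof -
  show "leibniz_defect (x * y) y' = x * leibniz_defect y y'"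
    using assms by (simp add: leibniz_defect_def der_diag_offdiag der_diag_diag ring_distribs
      mult.assoc)
  have "der (y * y' * x) = der (y * y') * x + y * y' * der x"
    using assms by (simp only: der_diag_diag graded_mult)
  then show "leibniz_defect y (y' * x) = leibniz_defect y y' * x"
    using assms by (simp add: leibniz_defect_def der_diag_offdiag ring_distribs mult.assoc)
  show "leibniz_defect (y * x) y' = leibniz_defect y (x * y')"
    using assms by (simp add: leibniz_defect_def der_diag_offdiag ring_distribs mult.assoc)
qed

text \<open>
  The odd element \<open>y * y' * y''\<close> is a product of an even and an odd factor in two ways.
\<close>

lemma leibniz_defect_cocycle:
  assumes "y \<in> offdiag" "y' \<in> offdiag" "y'' \<in> offdiag"
  shows "leibniz_defect y y' * y'' = y * leibniz_defect y' y''"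
proof -
  have "der (y * y') * y'' + y * y' * der y'' = der (y * y' * y'')"
    using assms by (simp only: der_diag_offdiag graded_mult)
  also have "\<dots> = der (y * (y' * y''))" by (simp add: mult.assoc)
  also have "\<dots> = der y * (y' * y'') + y * der (y' * y'')"
    using assms by (simp only: der_diag_offdiag graded_mult)
  finally show ?thesis by (simp add: leibniz_defect_def ring_distribs mult.assoc algebra_simps)
qed

lemma leibniz_defect_commutator:
  assumes "y \<in> offdiag" "y' \<in> offdiag"
  shows "leibniz_defect y y' - leibniz_defect y' y = - gamma (commutator y y')"
proof -
  have "der (y * y') - der (y' * y) = der (commutator y y')" by (simp add: commutator_def der_lin)
  also have "\<dots> = commutator (der y) y' + commutator y (der y') - gamma (commutator y y')"
    using assms by (simp add: der_offdiag offdiag_offdiag der_def[of "commutator y y'"])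
  finally show ?thesis by (simp add: leibniz_defect_def commutator_def algebra_simps)
qed

lemma leibniz_defect_central:
  assumes "y \<in> offdiag" "y' \<in> offdiag"
  shows "leibniz_defect y y' - leibniz_defect y' y \<in> centre UNIV"
  unfolding leibniz_defect_commutator[OF assms] using gamma_central by simp

lemma leibniz_defect_corner:
  assumes "complementary g h" "y \<in> offdiag" "y' \<in> offdiag" "g * y = y"
  shows "leibniz_defect y y' \<in> corner g" "leibniz_defect y' y \<in> corner h"
proof -
  have "g * leibniz_defect y y' = leibniz_defect y y'"
    using leibniz_defect_module(1)[OF complementary_simps(9)[OF assms(1)] assms(2,3)] assms(4)
      by simp
  then show "leibniz_defect y y' \<in> corner g" using leibniz_defect_diag assms
    by (simp add: corner_def)
  have "leibniz_defect y' y * h = leibniz_defect y' y"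
    using leibniz_defect_module(2)[OF complementary_simps(10)[OF assms(1)] assms(3,2)] assms(4)
      complementary_simps(17)[OF assms(1,2)] by simp
  then show "leibniz_defect y' y \<in> corner h"
    using leibniz_defect_diag[OF assms(3,2)] complementary_simps(13)[OF assms(1)]
    by (simp add: corner_def)
qed

lemma leibniz_defect_corner_central:
  assumes "complementary g h" "y \<in> offdiag" "y' \<in> offdiag" "g * y = y"
  shows "leibniz_defect y y' = g * (leibniz_defect y y' - leibniz_defect y' y)"
    "leibniz_defect y' y = h * (leibniz_defect y' y - leibniz_defect y y')"
proof -
  note c = leibniz_defect_corner[OF assms]
  have "g * leibniz_defect y y' = leibniz_defect y y'"
    "h * leibniz_defect y' y = leibniz_defect y' y"
    using c by (simp_all add: corner_def)
  moreover have "h * leibniz_defect y y' = 0" "g * leibniz_defect y' y = 0"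
    using c corner_iff[OF assms(1)] corner_iff[OF complementary_sym[OF assms(1)]] by blast+
  ultimately show "leibniz_defect y y' = g * (leibniz_defect y y' - leibniz_defect y' y)"
    "leibniz_defect y' y = h * (leibniz_defect y' y - leibniz_defect y y')"
    by (simp_all add: right_diff_distrib)
qed

text \<open>
  Let \<open>u\<close> denote the defect. Vanishing on one odd block in the first argument is enough: \<open>u y y' - u y' y\<close>
  is central and its two terms lie in different corners, so that \<open>u y y' = 0\<close> gives \<open>u y' y = 0\<close>. If
  both arguments lie in the other block, balancing moves an idempotent that annihilates the second
  one.
\<close>

lemma leibniz_defect_vanishes:
  assumes "complementary g h" and 0: "\<And>y y'. \<lbrakk>y \<in> offdiag; y' \<in> offdiag; g * y = y\<rbrakk>
    \<Longrightarrow> leibniz_defect y y' = 0"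
    and y: "y \<in> offdiag" "y' \<in> offdiag"
  shows "leibniz_defect y y' = 0"
proof -
  note [simp] = complementary_simps(5,6,7,8,9,10)[OF assms(1)] y
  have 1: "leibniz_defect z' z = 0" if "z \<in> offdiag" "z' \<in> offdiag" "g * z = z" for z z'
  proof -
    have "leibniz_defect z' z = h * (leibniz_defect z' z - leibniz_defect z z')"
      by (rule leibniz_defect_corner_central(2)[OF assms(1) that])
    moreover have "leibniz_defect z' z - leibniz_defect z z' \<in> centre UNIV"
      using that leibniz_defect_central by simp
    moreover have "leibniz_defect z z' = 0" using 0 that by simp
    ultimately have "leibniz_defect z' z \<in> centre UNIV" "leibniz_defect z' z \<in> corner h"
      using leibniz_defect_corner(2)[OF assms(1) that] by simp_all
    then show ?thesis by (rule central_corner_zero[OF complementary_sym[OF assms(1)]])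
  qed
  have "leibniz_defect (g * y) y' = 0" by (rule 0) simp_all
  moreover have "leibniz_defect (h * y) (g * y') = 0" by (rule 1) simp_all
  moreover have "leibniz_defect (h * y) (h * y') = 0"
  proof -
    have "leibniz_defect (h * y) (h * y') = leibniz_defect (h * y * g) (h * y')"
      using complementary_simps(15)[OF assms(1), of "h * y"] by simp
    also have "\<dots> = leibniz_defect (h * y) (g * (h * y'))"
      by (rule leibniz_defect_module(3)) simp_all
    finally show ?thesis by (simp add: leibniz_defect_zero)
  qed
  ultimately have "leibniz_defect (g * y + h * y) (g * y' + h * y') = 0"
    using complementary_sum[OF assms(1), of y']
      by (simp only: leibniz_defect_add(1)) (metis leibniz_defect_add(2) add.right_neutral)
  then show ?thesis unfolding complementary_sum[OF assms(1)] .
qed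

text \<open>
  Multiplying the defect by a corner element \<open>a\<close> gives the defect of \<open>a * y\<close>, whose value is the corner
  component of a central element. So the defect generates a central ideal of the corner.
\<close>

lemma leibniz_defect_vanishes_no_central_ideal:
  assumes "complementary g h" "\<And>I. central_ideal scale I (corner g) \<Longrightarrow> I = {0}"
    and "y \<in> offdiag" "y' \<in> offdiag"
  shows "leibniz_defect y y' = 0"
proof (rule leibniz_defect_vanishes[OF assms(1) _ assms(3,4)])
  fix y y' assume y: "y \<in> offdiag" "y' \<in> offdiag" "g * y = y"
  show "leibniz_defect y y' = 0"
  proof (rule principal_central_ideal[OF assms(1,2)])
    show "leibniz_defect y y' \<in> corner g" by (rule leibniz_defect_corner(1)[OF assms(1) y])
    fix a assume a: "a \<in> corner g"
    have ay: "a * y \<in> offdiag" "g * (a * y) = a * y"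
      using a y by (simp_all add: corner_def flip: mult.assoc)
    have "a * leibniz_defect y y' = leibniz_defect (a * y) y'"
      using leibniz_defect_module(1) corner_diag[OF a] y by simp
    also have "\<dots> = g * (leibniz_defect (a * y) y' - leibniz_defect y' (a * y))"
      by (rule leibniz_defect_corner_central(1)[OF assms(1) ay(1) y(2) ay(2)])
    also have "\<dots> \<in> centre (corner g)" using central_corner[OF assms(1)] leibniz_defect_central ay y
      by simp
    finally show "a * leibniz_defect y y' \<in> centre (corner g)" .
  qed
qed

text \<open>
  Let \<open>u\<close> denote the defect. By the cocycle rule \<open>u m t * m = m * u t m\<close>, so \<open>u m t + u t m\<close> is
  central by the hypothesis on \<open>m\<close>. Since \<open>u m t - u t m\<close> is central too, \<open>2 * u m t\<close> is a central
  element of a corner and vanishes. For any other \<open>y\<close> in the block of \<open>m\<close> it follows that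
  \<open>u y y' * m = y * u y' m = 0\<close>, and the hypothesis on \<open>m\<close> applies with \<open>b = 0\<close>.
\<close>

lemma leibniz_defect_vanishes_detecting_element:
  assumes "complementary g h" "m \<in> offdiag" "g * m = m"
    and det: "\<And>a b. \<lbrakk>a \<in> sandwich g (centre UNIV) g; b \<in> sandwich h (centre UNIV) h; a * m = m * b\<rbrakk>
      \<Longrightarrow> a + b \<in> centre UNIV"
    and "y \<in> offdiag" "y' \<in> offdiag"
  shows "leibniz_defect y y' = 0"
proof (rule leibniz_defect_vanishes[OF assms(1) _ assms(5,6)])
  have sw: "leibniz_defect y t \<in> sandwich g (centre UNIV) g"
    "leibniz_defect t y \<in> sandwich h (centre UNIV) h"
    if "y \<in> offdiag" "t \<in> offdiag" "g * y = y" for y t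
  proof -
    have "g * (leibniz_defect y t - leibniz_defect t y) \<in> sandwich g (centre UNIV) g"
      "h * (leibniz_defect t y - leibniz_defect y t) \<in> sandwich h (centre UNIV) h"
      using central_sandwich assms(1) complementary_sym[OF assms(1)] leibniz_defect_central that
        by blast+
    then show "leibniz_defect y t \<in> sandwich g (centre UNIV) g"
      "leibniz_defect t y \<in> sandwich h (centre UNIV) h"
      using leibniz_defect_corner_central[OF assms(1) that] by simp_all
  qed
  have m0: "leibniz_defect t m = 0" if t: "t \<in> offdiag" for t
  proof -
    have "leibniz_defect m t + leibniz_defect t m \<in> centre UNIV"
      by (rule det[OF sw[OF assms(2) t assms(3)] leibniz_defect_cocycle[OF assms(2) t assms(2)]])
    then have "(leibniz_defect m t + leibniz_defect t m)
      + (leibniz_defect m t - leibniz_defect t m) \<in> centre UNIV"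
      using leibniz_defect_central[OF assms(2) t] by blast
    then have "leibniz_defect m t + leibniz_defect m t \<in> centre UNIV" by simp
    moreover have "leibniz_defect m t + leibniz_defect m t \<in> corner g"
      using leibniz_defect_corner(1)[OF assms(1,2) t assms(3)] corner_closed(1) by blast
    ultimately have "leibniz_defect m t + leibniz_defect m t = 0"
      by (rule central_corner_zero[OF assms(1)])
    then have "leibniz_defect m t = 0" by (rule two_torsion_free)
    with \<open>leibniz_defect m t + leibniz_defect t m \<in> centre UNIV\<close>
      have "leibniz_defect t m \<in> centre UNIV" by simp
    then show ?thesis
      using central_corner_zero[OF complementary_sym[OF assms(1)]]
        leibniz_defect_corner(2)[OF assms(1,2) t assms(3)] by blast
  qed
  fix y y' assume y: "y \<in> offdiag" "y' \<in> offdiag" "g * y = y"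
  have "leibniz_defect y y' * m = m * 0"
    using leibniz_defect_cocycle[OF y(1,2) assms(2)] m0[OF y(2)] by simp
  moreover have "0 \<in> sandwich h (centre UNIV) h" unfolding sandwich_def
    by (force intro!: exI[of _ 0])
  ultimately have "leibniz_defect y y' + 0 \<in> centre UNIV" using det sw(1)[OF y] by blast
  then show "leibniz_defect y y' = 0"
    using central_corner_zero[OF assms(1)] leibniz_defect_corner(1)[OF assms(1) y] by simp
qed

text \<open>
  The central element \<open>W\<close> formed from \<open>t * m\<close> and \<open>m * t\<close> has the same component in one corner as the
  correction of \<open>m * t\<close>, and in the other corner as the correction of \<open>t * m\<close>. Hence it equals both,
  and \<open>gamma\<close> vanishes on \<open>[m, t]\<close>.
\<close>

lemma leibniz_defect_vanishes_central_values:
  assumes c: "\<And>m t. \<lbrakk>m \<in> offdiag; t \<in> offdiag; e * m = m; f * t = t\<rbrakk>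
      \<Longrightarrow> e * \<psi> (t * m) * e + f * \<psi> (m * t) * f \<in> centre UNIV"
    and "y \<in> offdiag" "y' \<in> offdiag"
  shows "leibniz_defect y y' = 0"
proof (rule leibniz_defect_vanishes[OF complementary_ef(1) _ assms(2,3)])
  fix y y' assume y: "y \<in> offdiag" "y' \<in> offdiag" "e * y = y"
  define t where "t = f * y'"
  have t: "t \<in> offdiag" "f * t = t" using y by (simp_all add: t_def)
  have "y * f = y" using y by (simp add: graded)
  then have eq: "leibniz_defect y y' = leibniz_defect y t"
    using leibniz_defect_module(3)[OF _ y(1,2), of f] by (simp add: t_def)
  have yt: "y * t \<in> corner e" "t * y \<in> corner f"
    using y t by (simp_all add: corner_def flip: mult.assoc)
  define W where "W = e * \<psi> (t * y) * e + f * \<psi> (y * t) * f"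
  have W: "W \<in> centre UNIV" unfolding W_def by (rule c[OF y(1) t(1) y(3) t(2)])
  have d: "\<psi> (t * y) \<in> diag" "\<psi> (y * t) \<in> diag" using y t by (simp_all add: diag)
  have z: "correction e (y * t) \<in> centre UNIV" "correction f (t * y) \<in> centre UNIV"
    "\<psi> (y * t) - correction e (y * t) \<in> corner e" "\<psi> (t * y) - correction f (t * y) \<in> corner f"
    using correction[OF complementary_ef(1), of "y * t"]
      correction[OF complementary_ef(2), of "t * y"]
      corner_sandwich_id[OF complementary_ef(1) yt(1)]
        corner_sandwich_id[OF complementary_ef(2) yt(2)] by simp_all
  have "f * (W - correction e (y * t)) = 0"
    using z(3) d z(1,2)[THEN central_diag] corner_iff[OF complementary_ef(1)]
      by (simp add: W_def ring_distribs graded mult.assoc)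
  then have 1: "W = correction e (y * t)" using central_zero[of "W - correction e (y * t)" f] W z
    by simp
  have "e * (W - correction f (t * y)) = 0"
    using z(4) d z(1,2)[THEN central_diag] corner_iff[OF complementary_ef(2)]
      by (simp add: W_def ring_distribs graded mult.assoc)
  then have 2: "W = correction f (t * y)" using central_zero[of "W - correction f (t * y)" e] W z
    by simp
  have "gamma (commutator y t) = 0"
    using 1 2 gamma_corner[OF complementary_ef(1) yt(1)] gamma_corner[OF complementary_ef(2) yt(2)]
    by (simp add: commutator_def module_hom.diff[OF gamma_hom])
  then have "leibniz_defect y t - leibniz_defect t y = 0"
    using leibniz_defect_commutator[OF y(1) t(1)] by simp
  then show "leibniz_defect y y' = 0"
    using leibniz_defect_corner_central(1)[OF complementary_ef(1) y(1) t(1) y(3)] eq by simp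
qed

lemma leibniz_defect_vanishes_products:
  assumes "\<And>y y'. \<lbrakk>y \<in> offdiag; y' \<in> offdiag\<rbrakk> \<Longrightarrow> y * y' = 0"
    and "y \<in> offdiag" "y' \<in> offdiag"
  shows "leibniz_defect y y' = 0"
  using assms by (simp add: leibniz_defect_def der_lin der_grading)

lemma der_derivation:
  assumes zero: "\<And>y y'. \<lbrakk>y \<in> offdiag; y' \<in> offdiag\<rbrakk> \<Longrightarrow> leibniz_defect y y' = 0"
  shows "derivation scale der"
  unfolding derivation_def
proof (intro conjI allI der_hom)
  fix x y
  obtain x0 x1 where x: "x = x0 + x1" "x0 \<in> diag" "x1 \<in> offdiag" by (rule grading_cases)
  obtain y0 y1 where y: "y = y0 + y1" "y0 \<in> diag" "y1 \<in> offdiag" by (rule grading_cases)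
  have "der (x1 * y1) = der x1 * y1 + x1 * der y1"
    using zero[OF x(3) y(3)] by (simp add: leibniz_defect_def)
  then show "der (x * y) = der x * y + x * der y"
    using x y by (simp add: ring_distribs der_lin der_diag_offdiag der_diag_diag)
qed

end


section \<open>Singular Jordan derivations\<close>

text \<open>
  The double commutator is a difference of iterated Jordan products:
  $[[x,y],z] = x \circ (y \circ z) - y \circ (x \circ z)$.
\<close>

lemma jordan_derivation_lie_triple:
  assumes "jordan_derivation scale h"
  shows "h (commutator (commutator x y) z) =
     commutator (commutator (h x) y) z + commutator (commutator x (h y)) z
     + commutator (commutator x y) (h z)"
proof -
  have J: "h (jordan_prod x y) = jordan_prod (h x) y + jordan_prod x (h y)" for x y
    using assms by (simp add: jordan_derivation_def)
  have D: "h (x - y) = h x - h y" for x y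
    using assms module_hom.diff by (auto simp: jordan_derivation_def)
  have T: "commutator (commutator x y) z = jordan_prod x (jordan_prod y z) - jordan_prod y
    (jordan_prod x z)"
    for x y z :: 'b
    by (simp add: commutator_def jordan_prod_def algebra_simps)
  have A: "jordan_prod x (y + z) = jordan_prod x y + jordan_prod x z" for x y z :: 'b
    by (simp add: jordan_prod_def algebra_simps)
  show ?thesis
    unfolding T J D A by (simp add: algebra_simps)
qed

text \<open>
  The properties that the part of a normalised Lie \<open>n\<close>-derivation anticommuting with \<open>s\<close> turns out
  to have.
\<close>

locale graded_singular_jordan = peirce scale e f
  for scale :: "'r::comm_ring_1 \<Rightarrow> 'a::ring_1 \<Rightarrow> 'a" and e f :: 'a +
  fixes \<delta> :: "'a \<Rightarrow> 'a"
  assumes hom: "module_hom scale scale \<delta>"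
    and diag: "x \<in> diag \<Longrightarrow> \<delta> x = 0"
    and offdiag: "y \<in> offdiag \<Longrightarrow> \<delta> y \<in> offdiag"
    and s_mult: "y \<in> offdiag \<Longrightarrow> \<delta> (s * y) = - (s * \<delta> y)"
    and diag_offdiag: "\<lbrakk>x \<in> diag; y \<in> offdiag\<rbrakk> \<Longrightarrow> \<delta> (commutator x y) = - commutator x (\<delta> y)"
    and offdiag_offdiag: "\<lbrakk>y \<in> offdiag; y' \<in> offdiag\<rbrakk> \<Longrightarrow> commutator (\<delta> y) y' = commutator y (\<delta> y')"
begin

lemmas lin = module_hom.add[OF hom] module_hom.diff[OF hom] module_hom.neg[OF hom]
  module_hom.zero[OF hom] module_hom.scale[OF hom]

lemma mult_diag:
  assumes "x \<in> diag" "y \<in> offdiag"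
  shows "\<delta> (x * y) = \<delta> y * x" "\<delta> (y * x) = x * \<delta> y"
proof -
  have "s * \<delta> (x * y + y * x) = - \<delta> (commutator (s * x) y)"
    unfolding jordan_s[OF assms] using assms by (simp add: s_mult)
  also have "\<dots> = commutator (s * x) (\<delta> y)"
    using assms by (simp add: diag_offdiag)
  also have "\<dots> = s * (x * \<delta> y + \<delta> y * x)"
    using assms by (simp add: jordan_s offdiag)
  finally have J: "\<delta> (x * y + y * x) = x * \<delta> y + \<delta> y * x"
    by (simp add: s_cancel)
  show "\<delta> (x * y) = \<delta> y * x"
  proof (rule double_cancel)
    have "\<delta> (x * y) + \<delta> (x * y) = \<delta> (commutator x y) + \<delta> (x * y + y * x)"
      unfolding lin(1)[symmetric] double_mult(1) ..
    then show "\<delta> (x * y) + \<delta> (x * y) = \<delta> y * x + \<delta> y * x"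
      unfolding diag_offdiag[OF assms] J by (simp add: commutator_def)
  qed
  show "\<delta> (y * x) = x * \<delta> y"
  proof (rule double_cancel)
    have "\<delta> (y * x) + \<delta> (y * x) = \<delta> (x * y + y * x) - \<delta> (commutator x y)"
      unfolding lin(1,2)[symmetric] double_mult(2) ..
    then show "\<delta> (y * x) + \<delta> (y * x) = x * \<delta> y + x * \<delta> y"
      unfolding diag_offdiag[OF assms] J by (simp add: commutator_def)
  qed
qed

text \<open>
  The rule for commutators of odd elements, applied to \<open>s * y\<close>, becomes one for Jordan products. Adding
  and subtracting the two isolates the single products.
\<close>

lemma anticommute:
  assumes y: "y \<in> offdiag" "y' \<in> offdiag"
  shows "\<delta> y * y' = - (\<delta> y' * y)" "y * \<delta> y' = - (y' * \<delta> y)"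
proof -
  have "commutator (\<delta> (s * y)) y' = commutator (s * y) (\<delta> y')"
    by (rule offdiag_offdiag) (use y in simp_all)
  then have "s * - (\<delta> y * y' + y' * \<delta> y) = s * (y * \<delta> y' + \<delta> y' * y)"
    using y offdiag by (simp add: s_mult commutator_def ring_distribs graded mult.assoc)
  then have 1: "- (\<delta> y * y' + y' * \<delta> y) = y * \<delta> y' + \<delta> y' * y"
    by (simp only: s_cancel)
  have 2: "\<delta> y * y' - y' * \<delta> y = y * \<delta> y' - \<delta> y' * y"
    using offdiag_offdiag[OF y] by (simp add: commutator_def)
  have "\<delta> y * y' + \<delta> y * y' = (\<delta> y * y' - y' * \<delta> y) - - (\<delta> y * y' + y' * \<delta> y)"
    by simp
  also have "\<dots> = - (\<delta> y' * y) + - (\<delta> y' * y)"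
    unfolding 1 2 by simp
  finally show 3: "\<delta> y * y' = - (\<delta> y' * y)"
    by (rule double_cancel)
  then show "y * \<delta> y' = - (y' * \<delta> y)"
    using 2 by (simp add: algebra_simps)
qed

lemma is_jordan_derivation: "jordan_derivation scale \<delta>"
  unfolding jordan_derivation_def
proof (intro conjI hom allI)
  fix x y
  obtain x0 x1 where x: "x = x0 + x1" "x0 \<in> diag" "x1 \<in> offdiag" by (rule grading_cases)
  obtain y0 y1 where y: "y = y0 + y1" "y0 \<in> diag" "y1 \<in> offdiag" by (rule grading_cases)
  show "\<delta> (jordan_prod x y) = jordan_prod (\<delta> x) y + jordan_prod x (\<delta> y)"
    using x y anticommute[OF x(3) y(3)]
    by (simp add: jordan_prod_def ring_distribs lin mult_diag diag)
qed

lemma singular: "singular_jordan_derivation scale e \<delta>"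
proof -
  have z: "\<delta> ` sandwich g UNIV g = {0}" if "complementary g h" for g h
    using corner_closed(3)[of g] sandwich_corner[OF that] corner_diag diag
      by (force simp: image_iff)
  have o: "\<delta> ` sandwich g UNIV h \<subseteq> sandwich h UNIV g" if g: "complementary g h" for g h
  proof clarify
    fix y assume "y \<in> sandwich g UNIV h"
    then have y: "y \<in> offdiag" "g * y = y"
      using sandwich_offdiag[of g h] g by (auto simp: complementary_def)
    have "\<delta> (g * y) = \<delta> y * g" by (rule mult_diag) (use g y in \<open>auto simp: complementary_simps\<close>)
    then have "h * \<delta> y = \<delta> y" using y complementary_simps(15)[OF g offdiag[OF y(1)]] by simp
    then show "\<delta> y \<in> sandwich h UNIV g"
      using sandwich_offdiag[of h g] g offdiag[OF y(1)] by (auto simp: complementary_def)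
  qed
  show ?thesis
    unfolding singular_jordan_derivation_def Let_def f_eq[symmetric]
    using is_jordan_derivation z[OF complementary_ef(1)] z[OF complementary_ef(2)]
      o[OF complementary_ef(1)] o[OF complementary_ef(2)] by blast
qed

text \<open>
  Let \<open>b = [y, y']\<close> and \<open>c = [y, \<delta> y']\<close>. Evaluating \<open>\<delta> [b, z]\<close> once as a value of an even-odd
  commutator and once by the Lie triple rule gives \<open>[c, z] = - [b, \<delta> z]\<close>. Replacing \<open>z\<close> by
  \<open>s * z\<close> changes the sign of the right-hand side only, up to the common factor \<open>s\<close>, so both sides
  vanish.
\<close>

lemma commutator_image_central:
  assumes y: "y \<in> offdiag" "y' \<in> offdiag"
  shows "commutator y (\<delta> y') \<in> centre UNIV"
proof (rule centralI)
  show "commutator y (\<delta> y') \<in> diag" using y offdiag by simp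
  define c where "c = commutator y (\<delta> y')"
  define b where "b = commutator y y'"
  have d: "c \<in> diag" "b \<in> diag" using y offdiag by (simp_all add: c_def b_def)
  have *: "commutator c z = - commutator b (\<delta> z)" if z: "z \<in> offdiag" for z
  proof (rule double_cancel)
    have "- commutator b (\<delta> z) = \<delta> (commutator b z)" using d z by (simp add: diag_offdiag)
    also have "\<dots> = commutator c z + commutator c z + commutator b (\<delta> z)"
      unfolding b_def jordan_derivation_lie_triple[OF is_jordan_derivation]
      using offdiag_offdiag[OF y] by (simp add: c_def)
    finally have e: "- commutator b (\<delta> z) = \<dots>" .
    show "commutator c z + commutator c z = - commutator b (\<delta> z) + - commutator b (\<delta> z)"
      using arg_cong[OF e, of "\<lambda>v. v - commutator b (\<delta> z)"] by simp
  qed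
  fix z assume z: "z \<in> offdiag"
  have ds: "commutator a (s * v) = s * commutator a v" if "a \<in> diag" for a v
    using that by (simp add: commutator_def graded ring_distribs mult.assoc)
  have "s * commutator c z = s * commutator b (\<delta> z)"
    using *[of "s * z"] z by (simp add: s_mult commutator_simps ds d)
  then have "commutator c z = commutator b (\<delta> z)" by (simp only: s_cancel)
  then have "commutator c z = - commutator c z" using *[OF z] by simp
  then show "commutator (commutator y (\<delta> y')) z = 0"
    unfolding c_def by (rule eq_minus_imp_zero)
qed

lemma antiderivationI:
  assumes "\<And>y y'. \<lbrakk>y \<in> offdiag; y' \<in> offdiag\<rbrakk> \<Longrightarrow> y * \<delta> y' = 0"
    and "\<And>y y'. \<lbrakk>y \<in> offdiag; y' \<in> offdiag\<rbrakk> \<Longrightarrow> \<delta> y * y' = 0"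
  shows "antiderivation scale \<delta>"
  unfolding antiderivation_def
proof (intro conjI hom allI)
  fix x y
  obtain x0 x1 where x: "x = x0 + x1" "x0 \<in> diag" "x1 \<in> offdiag" by (rule grading_cases)
  obtain y0 y1 where y: "y = y0 + y1" "y0 \<in> diag" "y1 \<in> offdiag" by (rule grading_cases)
  show "\<delta> (x * y) = \<delta> y * x + y * \<delta> x"
    using x y assms by (simp add: ring_distribs lin mult_diag diag)
qed

text \<open>
  The component at \<open>g\<close> of the central element \<open>[y, \<delta> y']\<close> is a single product, \<open>y * \<delta> y'\<close> or
  \<open>- (\<delta> y' * y)\<close>, according to the block of \<open>y\<close>. It generates a central ideal of the corner, so it
  vanishes, and then \<open>[y, \<delta> y'] = 0\<close>. Replacing \<open>y\<close> by \<open>s * y\<close> separates the two products.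
\<close>

lemma antiderivation_no_central_ideal:
  assumes "complementary g h" "\<And>I. central_ideal scale I (corner g) \<Longrightarrow> I = {0}"
  shows "antiderivation scale \<delta>"
proof -
  note o = complementary_simps[OF assms(1)]
  have g_part: "g * commutator y (\<delta> y') = y * \<delta> y'" "y * \<delta> y' \<in> corner g"
    if "y \<in> offdiag" "y' \<in> offdiag" "g * y = y" for y y'
  proof -
    have "g * (\<delta> y' * y) = \<delta> y' * (h * y)" using o(18)[OF offdiag[OF that(2)]] by simp
    also have "h * y = h * (g * y)" using that by simp
    finally have "g * (\<delta> y' * y) = 0" by (simp add: o)
    moreover have "g * (y * \<delta> y') = y * \<delta> y'" using that by (simp flip: mult.assoc)
    ultimately show "g * commutator y (\<delta> y') = y * \<delta> y'" "y * \<delta> y' \<in> corner g"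
      using that offdiag by (simp_all add: commutator_def right_diff_distrib corner_def)
  qed
  have h_part: "g * commutator y (\<delta> y') = - (\<delta> y' * y)" "\<delta> y' * y \<in> corner g"
    if "y \<in> offdiag" "y' \<in> offdiag" "h * y = y" for y y'
  proof -
    have 1: "g * (\<delta> y' * y) = \<delta> y' * y" using o(18)[OF offdiag[OF that(2)], of y] that by simp
    have "g * (y * \<delta> y') = g * (h * y) * \<delta> y'" using that by (simp add: mult.assoc)
    then have "g * (y * \<delta> y') = 0" by (simp add: o)
    with 1 show "g * commutator y (\<delta> y') = - (\<delta> y' * y)" "\<delta> y' * y \<in> corner g"
      using that offdiag by (simp_all add: commutator_def right_diff_distrib corner_def)
  qed
  have central: "g * commutator y (\<delta> y') \<in> centre (corner g)" if "y \<in> offdiag" "y' \<in> offdiag"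
    for y y'
    using central_corner[OF assms(1)] commutator_image_central that by blast
  have neg: "- z \<in> centre (corner g)" if "z \<in> centre (corner g)" for z
    using that corner_closed(2)[OF corner_closed(3)[of g], of z] by (simp add: centre_def)
  have 1: "commutator y (\<delta> y') = 0" if y: "y \<in> offdiag" "y' \<in> offdiag" "g * y = y" for y y'
  proof -
    have "y * \<delta> y' = 0"
    proof (rule principal_central_ideal[OF assms g_part(2)[OF y]])
      fix a assume a: "a \<in> corner g"
      have ay: "a * y \<in> offdiag" "g * (a * y) = a * y"
        using a y by (simp_all add: corner_def flip: mult.assoc)
      show "a * (y * \<delta> y') \<in> centre (corner g)"
        using central[OF ay(1) y(2)] unfolding g_part(1)[OF ay(1) y(2) ay(2)]
          by (simp add: mult.assoc)
    qed
    then show ?thesis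
      using g_part(1)[OF y] commutator_image_central[OF y(1,2)] central_zero[of _ g] assms(1)
        by (auto simp: complementary_def)
  qed
  have 2: "commutator y (\<delta> y') = 0" if y: "y \<in> offdiag" "y' \<in> offdiag" "h * y = y" for y y'
  proof -
    have "\<delta> y' * y = 0"
    proof (rule principal_central_ideal[OF assms h_part(2)[OF y]])
      fix a assume a: "a \<in> corner g"
      have "a * (\<delta> y' * y) = \<delta> (y' * a) * y"
        using mult_diag(2)[OF corner_diag[OF a] y(2)] by (simp add: mult.assoc)
      moreover have ya: "y' * a \<in> offdiag" using y(2) corner_diag[OF a] by simp
      ultimately show "a * (\<delta> y' * y) \<in> centre (corner g)"
        using neg[OF central[OF y(1) ya]] unfolding h_part(1)[OF y(1) ya y(3)] by simp
    qed
    then show ?thesis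
      using h_part(1)[OF y] commutator_image_central[OF y(1,2)] central_zero[of _ g] assms(1)
        by (auto simp: complementary_def)
  qed
  have c: "commutator y (\<delta> y') = 0" if y: "y \<in> offdiag" "y' \<in> offdiag" for y y'
  proof -
    have "commutator (g * y) (\<delta> y') = 0" by (rule 1) (use y in \<open>simp_all add: o(5,9)\<close>)
    moreover have "commutator (h * y) (\<delta> y') = 0" by (rule 2) (use y in \<open>simp_all add: o(6,10)\<close>)
    ultimately have "commutator (g * y + h * y) (\<delta> y') = 0" by (simp add: commutator_simps)
    then show ?thesis unfolding complementary_sum[OF assms(1)] .
  qed
  have "y * \<delta> y' = 0 \<and> \<delta> y' * y = 0" if y: "y \<in> offdiag" "y' \<in> offdiag" for y y'
  proof -
    have "s * (y * \<delta> y' + \<delta> y' * y) = commutator (s * y) (\<delta> y')"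
      using y offdiag by (simp add: commutator_def ring_distribs graded mult.assoc)
    also have "\<dots> = s * 0" using c[of "s * y" y'] y by simp
    finally have a: "y * \<delta> y' + \<delta> y' * y = 0" unfolding s_cancel .
    have b: "y * \<delta> y' = \<delta> y' * y" using c[OF y] by (simp add: commutator_def)
    show ?thesis using a two_torsion_free[of "\<delta> y' * y"] unfolding b by simp
  qed
  then show ?thesis by (intro antiderivationI) blast+
qed

end


section \<open>The two parts of a normalised Lie \<open>n\<close>-derivation\<close>

lemma lie_leibniz_upd_above:
  "n < i \<Longrightarrow> lie_leibniz h n (x(i := v)) = lie_leibniz h n x"
  by (induction h n x rule: lie_leibniz.induct) auto

locale normalized_lie = peirce scale e f
  for scale :: "'r::comm_ring_1 \<Rightarrow> 'a::ring_1 \<Rightarrow> 'a" and e f :: 'a +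
  fixes n :: nat and \<phi> :: "'a \<Rightarrow> 'a"
  assumes n: "n \<ge> 2"
    and hom: "module_hom scale scale \<phi>"
    and lie: "\<phi> (lie_poly n x) = lie_leibniz \<phi> n x"
    and torsion_n: "of_nat (n - 1) * v = 0 \<Longrightarrow> v = (0::'a)"
    and e_diag: "\<phi> e \<in> diag"
begin

lemmas lin = module_hom.add[OF hom] module_hom.diff[OF hom] module_hom.neg[OF hom]
  module_hom.zero[OF hom] module_hom.scale[OF hom]

lemma s_power_diag [simp]: "s ^ k \<in> diag"
  by (induction k) simp_all

lemma s_power_square [simp]: "s ^ k * (s ^ k * x) = x"
proof -
  have "s ^ k * s ^ k = (s * s) ^ k" by (metis power_add power_mult mult_2 power2_eq_square)
  then show ?thesis by (simp flip: mult.assoc)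
qed

lemma of_nat_diag [simp]: "of_nat k \<in> diag"
  by (induction k) simp_all

lemma commutator_diag_e: "x \<in> diag \<Longrightarrow> commutator x e = 0"
  by (simp add: commutator_def graded)

text \<open>
  The sequence \<open>x, e, \<dots>, e\<close> with even \<open>x\<close> has Lie polynomial \<open>0\<close>. Its Leibniz sum is the odd part
  of \<open>\<phi> x\<close> times a power of \<open>s\<close>, plus \<open>[x, \<phi> e]\<close> if \<open>n = 2\<close>; the latter is even and cannot
  interfere.
\<close>

lemma diag_maps: assumes "x \<in> diag" shows "\<phi> x \<in> diag"
proof -
  define u where "u = (\<lambda>_::nat. e)(Suc 0 := x)"
  have u: "u (Suc 0) = x" "u (Suc (Suc k)) = e" for k by (simp_all add: u_def)
  have L: "lie_poly (Suc (Suc k)) u = 0" for k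
    using assms by (induction k) (simp_all add: commutator_diag_e commutator_simps u)
  have S: "lie_leibniz \<phi> (Suc (Suc k)) u
      = s ^ Suc k * odd_part (\<phi> x) + (if k = 0 then commutator x (\<phi> e) else 0)" for k
  proof (induction k)
    case 0
    show ?case by (simp add: commutator_e u)
  next
    case (Suc k)
    have "lie_leibniz \<phi> (Suc (Suc (Suc k))) u = commutator (lie_leibniz \<phi> (Suc (Suc k)) u) e"
      using L[of k] by (simp add: commutator_simps u)
    also have "\<dots> = s * (s ^ Suc k * odd_part (\<phi> x))"
      unfolding Suc commutator_simps using assms e_diag
      by (simp add: commutator_offdiag_e commutator_diag_e commutator_simps)
    finally show ?case by (simp add: mult.assoc)
  qed
  obtain k where k: "n = Suc (Suc k)" using n by (metis Suc_le_D numeral_2_eq_2 Suc_le_mono)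
  define c where "c = (if k = 0 then commutator x (\<phi> e) else 0)"
  have "s ^ Suc k * odd_part (\<phi> x) + c = 0"
    using lie[of u] unfolding k L S c_def by (simp add: lin)
  moreover have "c \<in> diag" using assms e_diag by (simp add: c_def)
  ultimately have "s ^ Suc k * odd_part (\<phi> x) \<in> diag"
    by (metis add_eq_0_iff diag_closed(8) add.commute)
  moreover have "s ^ Suc k * odd_part (\<phi> x) \<in> offdiag"
    using s_power_diag graded_mult(1) odd_part_offdiag by blast
  ultimately have "s ^ Suc k * odd_part (\<phi> x) = 0" by (rule diag_offdiag_zero)
  then have "odd_part (\<phi> x) = 0" using s_power_square[of "Suc k"] by (metis mult_zero_right)
  then show ?thesis by (rule odd_part_eq_0)
qed

lemma s_string:
  assumes "y \<in> offdiag" "u (Suc 0) = y" "\<And>k. u (Suc (Suc k)) = e"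
  shows "lie_poly (Suc k) u = s ^ k * y"
  using assms by (induction k) (simp_all add: commutator_offdiag_e mult.assoc)

lemma commutator_left_diag:
  "a \<in> diag \<Longrightarrow> c \<in> diag \<Longrightarrow> a * c = c * a \<Longrightarrow> commutator (a * x) c = a * commutator x c"
  by (simp add: commutator_def right_diff_distrib) (metis mult.assoc)

lemma s_power_commute: "c \<in> diag \<Longrightarrow> s ^ k * c = c * s ^ k"
  by (induction k) (simp_all add: graded mult.assoc)

lemma of_nat_commute: "s * (of_nat k * x) = of_nat k * (s * (x::'a))"
  by (metis mult.assoc mult_of_nat_commute)

text \<open>
  The identity for the sequence \<open>y, e, \<dots>, e\<close> with odd \<open>y\<close>: each of the \<open>n - 1\<close> slots holding \<open>e\<close>
  contributes the same term.
\<close>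

lemma string_identity:
  assumes "y \<in> offdiag"
  shows "\<phi> (s ^ (n - 1) * y)
    = s ^ (n - 1) * odd_part (\<phi> y) + of_nat (n - 1) * (s ^ (n - 2) * commutator y (\<phi> e))"
proof -
  define u where "u = (\<lambda>_::nat. e)(Suc 0 := y)"
  have u: "u (Suc 0) = y" "u (Suc (Suc k)) = e" for k by (simp_all add: u_def)
  have S: "lie_leibniz \<phi> (Suc (Suc k)) u
      = s ^ Suc k * odd_part (\<phi> y) + of_nat (Suc k) * (s ^ k * commutator y (\<phi> e))" for k
  proof (induction k)
    case 0
    show ?case by (simp add: commutator_e u)
  next
    case (Suc k)
    have "lie_leibniz \<phi> (Suc (Suc (Suc k))) u
        = commutator (lie_leibniz \<phi> (Suc (Suc k)) u) e + commutator (s ^ Suc k * y) (\<phi> e)"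
      using s_string[OF assms u, of "Suc k"] by (simp add: u)
    also have "commutator (s ^ Suc k * y) (\<phi> e) = s ^ Suc k * commutator y (\<phi> e)"
      by (rule commutator_left_diag[OF s_power_diag e_diag s_power_commute[OF e_diag]])
    also have "commutator (lie_leibniz \<phi> (Suc (Suc k)) u) e
        = s * (s ^ Suc k * odd_part (\<phi> y)) + s * (of_nat (Suc k) * (s ^ k * commutator y (\<phi> e)))"
      unfolding Suc commutator_simps
      by (intro arg_cong2[of _ _ _ _ "(+)"] commutator_offdiag_e graded_mult graded_commutator
          s_power_diag of_nat_diag odd_part_offdiag assms e_diag)
    finally show ?case by (simp add: mult.assoc of_nat_commute ring_distribs del: of_nat_Suc)
      (simp add: ring_distribs)
  qed
  obtain k where k: "n = Suc (Suc k)" using n by (metis Suc_le_D numeral_2_eq_2 Suc_le_mono)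
  have "\<phi> (s ^ Suc k * y) = s ^ Suc k * odd_part (\<phi> y)
    + of_nat (Suc k) * (s ^ k * commutator y (\<phi> e))"
    using lie[of u] unfolding k S s_string[OF assms u] .
  then show ?thesis by (simp add: k)
qed

lemma offdiag_maps: assumes "y \<in> offdiag" shows "\<phi> y \<in> offdiag"
proof -
  have "\<phi> (s ^ (n - 1) * (s ^ (n - 1) * y)) \<in> offdiag"
    using assms e_diag by (subst string_identity) (auto intro!: offdiag_closed graded_mult)
  then show ?thesis by simp
qed

text \<open>
  Applying \<open>string_identity\<close> to \<open>y\<close> and again to \<open>s ^ (n - 1) * y\<close> returns to \<open>\<phi> y\<close> and leaves
  \<open>2 (n - 1) [y, \<phi> e]\<close> up to an invertible factor, which is where both torsion conditions are used.
\<close>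

lemma e_central: "\<phi> e \<in> centre UNIV"
proof (rule centralI[OF e_diag])
  fix y assume y: "y \<in> offdiag"
  let ?k = "n - 1" and ?j = "n - 2"
  let ?c = "commutator y (\<phi> e)"
  have A: "\<phi> (s ^ ?k * z) = s ^ ?k * \<phi> z + of_nat ?k * (s ^ ?j * commutator z (\<phi> e))"
    if "z \<in> offdiag" for z
    using string_identity[OF that] offdiag_maps[OF that] by simp
  have cm: "u * (of_nat k * v) = of_nat k * (u * v)" for k and u v :: 'a
    by (metis mult.assoc mult_of_nat_commute)
  have "\<phi> y = \<phi> (s ^ ?k * (s ^ ?k * y))" by simp
  also have "\<dots> = s ^ ?k * \<phi> (s ^ ?k * y) + of_nat ?k * (s ^ ?j * commutator (s ^ ?k * y) (\<phi> e))"
    by (rule A) (use y in simp)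
  also have "commutator (s ^ ?k * y) (\<phi> e) = s ^ ?k * ?c"
    by (rule commutator_left_diag[OF s_power_diag e_diag s_power_commute[OF e_diag]])
  also have "s ^ ?j * (s ^ ?k * ?c) = s ^ ?k * (s ^ ?j * ?c)"
    by (simp only: mult.assoc[symmetric] power_add[symmetric] add.commute)
  also have "s ^ ?k * \<phi> (s ^ ?k * y) = \<phi> y + of_nat ?k * (s ^ ?k * (s ^ ?j * ?c))"
    unfolding A[OF y] distrib_left s_power_square cm ..
  finally have "of_nat ?k * (s ^ ?k * (s ^ ?j * ?c)) + of_nat ?k * (s ^ ?k * (s ^ ?j * ?c)) = 0"
    by (simp add: add.assoc)
  then have "s ^ ?k * (s ^ ?j * ?c) = 0"
    by (rule torsion_n[OF two_torsion_free])
  then have "s ^ ?j * ?c = 0"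
    using s_power_square[of ?k "s ^ ?j * ?c"] by simp
  then have "?c = 0"
    using s_power_square[of ?j ?c] by simp
  then show "commutator (\<phi> e) y = 0" by (simp add: commutator_def)
qed

lemma commutator_phi_e: "commutator x (\<phi> e) = 0"
  by (rule commutator_central(1)[OF e_central])

lemma parity_identity: "y \<in> offdiag \<Longrightarrow> \<phi> (s ^ (n - 1) * y) = s ^ (n - 1) * \<phi> y"
  using string_identity[of y] offdiag_maps[of y] by (simp add: commutator_phi_e)

text \<open>
  The identity for the sequence \<open>x, y, e, \<dots>, e\<close>: since \<open>[x, y]\<close> is odd, the trailing slots
  contribute only the power of \<open>s\<close>, because \<open>\<phi> e\<close> is central.
\<close>

lemma head_identity:
  assumes "x \<in> diag" "y \<in> offdiag"
  shows "\<phi> (s ^ (n - 2) * commutator x y) = s ^ (n - 2) * (commutator (\<phi> x) y + commutator x (\<phi> y))"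
proof -
  define u where "u = (\<lambda>_::nat. e)(Suc 0 := x, Suc (Suc 0) := y)"
  have u: "u (Suc 0) = x" "u (Suc (Suc 0)) = y" "u (Suc (Suc (Suc k))) = e" for k
    by (simp_all add: u_def)
  have o: "commutator x y \<in> offdiag" "commutator (\<phi> x) y + commutator x (\<phi> y) \<in> offdiag"
    using assms diag_maps offdiag_maps by simp_all
  have L: "lie_poly (Suc (Suc k)) u = s ^ k * commutator x y" for k
    by (induction k) (simp_all add: commutator_offdiag_e o mult.assoc u)
  have S: "lie_leibniz \<phi> (Suc (Suc k)) u = s ^ k * (commutator (\<phi> x) y + commutator x (\<phi> y))" for k
  proof (induction k)
    case (Suc k)
    have "lie_leibniz \<phi> (Suc (Suc (Suc k))) u = commutator (lie_leibniz \<phi> (Suc (Suc k)) u) e"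
      by (simp add: commutator_phi_e u)
    also have "\<dots> = s * (s ^ k * (commutator (\<phi> x) y + commutator x (\<phi> y)))"
      unfolding Suc by (rule commutator_offdiag_e) (use o in simp)
    finally show ?case by (simp add: mult.assoc)
  qed (simp add: u)
  obtain k where k: "n = Suc (Suc k)" using n by (metis Suc_le_D numeral_2_eq_2 Suc_le_mono)
  show ?thesis using lie[of u] unfolding k L S by simp
qed

text \<open>
  The identity for the sequence \<open>y, e, \<dots>, e, y'\<close>. Placing \<open>y'\<close> in the last slot keeps the commutator
  \<open>[y, y']\<close> outermost; after two odd elements, a further \<open>e\<close> would annihilate it.
\<close>

lemma last_identity:
  assumes "y \<in> offdiag" "y' \<in> offdiag"
  shows "\<phi> (commutator (s ^ (n - 2) * y) y')
    = commutator (s ^ (n - 2) * \<phi> y) y' + commutator (s ^ (n - 2) * y) (\<phi> y')"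
proof -
  define u where "u = (\<lambda>_::nat. e)(Suc 0 := y)"
  have u: "u (Suc 0) = y" "u (Suc (Suc k)) = e" for k by (simp_all add: u_def)
  have S: "lie_leibniz \<phi> (Suc k) u = s ^ k * \<phi> y" for k
    using offdiag_maps[OF assms(1)]
    by (induction k) (simp_all add: commutator_offdiag_e commutator_phi_e mult.assoc u)
  obtain k where k: "n = Suc (Suc k)" using n by (metis Suc_le_D numeral_2_eq_2 Suc_le_mono)
  let ?x = "u(Suc (Suc k) := y')"
  have "lie_poly (Suc k) ?x = s ^ k * y" "lie_leibniz \<phi> (Suc k) ?x = s ^ k * \<phi> y"
    using S s_string[OF assms(1) u] lie_poly_upd_above[of "Suc k" "Suc (Suc k)" u]
      lie_leibniz_upd_above[of "Suc k" "Suc (Suc k)" \<phi> u] by simp_all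
  then show ?thesis using lie[of ?x] unfolding k by simp
qed

text \<open>
  The blocks of \<open>\<phi>\<close> that exchange $e\mathcal{A}f$ and $f\mathcal{A}e$; on odd elements this is the component of
  \<open>\<phi>\<close> that anticommutes with multiplication by \<open>s\<close>.
\<close>

definition singular_part :: "'a \<Rightarrow> 'a" where
  "singular_part x = f * \<phi> (e * x * f) * e + e * \<phi> (f * x * e) * f"

definition regular_part :: "'a \<Rightarrow> 'a" where
  "regular_part x = \<phi> x - singular_part x"

lemma singular_part_hom: "module_hom scale scale singular_part"
  by (auto simp: module_hom_iff module_axioms singular_part_def lin ring_distribs
    scale_right_distrib
      scale_mult_left[symmetric] scale_mult_right[symmetric])

lemma regular_part_hom: "module_hom scale scale regular_part"
  using module_hom.add[OF singular_part_hom] module_hom.scale[OF singular_part_hom]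
  by (simp add: module_hom_iff module_axioms regular_part_def lin scale_right_diff_distrib)

lemma singular_part_diag: "x \<in> diag \<Longrightarrow> singular_part x = 0"
  by (simp add: singular_part_def graded mult.assoc lin)

lemma singular_part_offdiag:
  assumes "y \<in> offdiag"
  shows "singular_part y = f * \<phi> (e * y) + e * \<phi> (f * y)" "singular_part y \<in> offdiag"
proof -
  show "singular_part y = f * \<phi> (e * y) + e * \<phi> (f * y)"
    using assms by (simp add: singular_part_def graded mult.assoc offdiag_maps)
  then show "singular_part y \<in> offdiag" using assms by (simp add: offdiag_maps)
qed

lemma phi_split: "\<phi> x = regular_part x + singular_part x"
  by (simp add: regular_part_def)

lemma singular_part_s: "y \<in> offdiag \<Longrightarrow> singular_part (s * y) = - (s * singular_part y)"
  by (simp add: singular_part_offdiag lin ring_distribs)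

lemma regular_part_s:
  assumes "y \<in> offdiag"
  shows "regular_part (s * y) = s * regular_part y"
proof -
  have R: "regular_part z = e * \<phi> (e * z) + f * \<phi> (f * z)" if z: "z \<in> offdiag" for z
  proof -
    have "\<phi> z = (e * \<phi> (e * z) + f * \<phi> (e * z)) + (e * \<phi> (f * z) + f * \<phi> (f * z))"
      unfolding e_plus_f_mult lin(1)[symmetric] ..
    then show ?thesis
      unfolding regular_part_def singular_part_offdiag(1)[OF z]
        by (simp only:) (simp add: algebra_simps)
  qed
  show ?thesis using assms by (simp add: R lin ring_distribs)
qed

lemma regular_part_diag: "x \<in> diag \<Longrightarrow> regular_part x = \<phi> x"
  by (simp add: regular_part_def singular_part_diag)

lemma regular_part_offdiag: "y \<in> offdiag \<Longrightarrow> regular_part y \<in> offdiag"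
  by (simp add: regular_part_def singular_part_offdiag(2) offdiag_maps)

lemma s_power_even: "even k \<Longrightarrow> s ^ k = 1" and s_power_odd: "odd k \<Longrightarrow> s ^ k = s"
proof -
  show 1: "even k \<Longrightarrow> s ^ k = 1" for k by (auto elim!: evenE simp: power_mult power2_eq_square)
  show "odd k \<Longrightarrow> s ^ k = s" by (auto elim!: oddE simp: 1)
qed

lemma singular_part_even: assumes "even n" "y \<in> offdiag" shows "singular_part y = 0"
proof -
  have "odd (n - 1)" using assms(1) n by auto
  then have "\<phi> (s * y) = s * \<phi> y"
    using parity_identity[OF assms(2)] s_power_odd[of "n - 1"] by simp
  then have "s * singular_part y = s * - singular_part y"
    using phi_split[of y] phi_split[of "s * y"] assms
      by (simp add: regular_part_s singular_part_s ring_distribs)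
  then have "singular_part y = - singular_part y" unfolding s_cancel .
  then show ?thesis by (rule eq_minus_imp_zero)
qed

lemma phi_s: "y \<in> offdiag \<Longrightarrow> \<phi> (s * y) = s * (regular_part y - singular_part y)"
  by (simp add: phi_split[of "s * y"] regular_part_s singular_part_s ring_distribs)

lemma commutator_s:
  "a \<in> diag \<Longrightarrow> commutator a (s * x) = s * commutator a x"
  "y \<in> offdiag \<Longrightarrow> z \<in> offdiag \<Longrightarrow> commutator (s * y) (s * z) = - commutator y z"
  by (simp_all add: commutator_def graded ring_distribs mult.assoc)

text \<open>
  For odd \<open>n\<close>, \<open>head_identity\<close> says that the defect \<open>L\<close> of the rule for the regular part equals the
  defect \<open>L'\<close> of the rule for the singular part. The former commutes and the latter anticommutes with
  multiplication of \<open>y\<close> by \<open>s\<close>, so both vanish.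
\<close>

lemma parts_diag_offdiag:
  assumes x: "x \<in> diag" and y: "y \<in> offdiag"
  shows "regular_part (commutator x y) = commutator (regular_part x) y
    + commutator x (regular_part y)"
    and "singular_part (commutator x y) = - commutator x (singular_part y)"
proof -
  have "regular_part (commutator x y) = commutator (regular_part x) y
    + commutator x (regular_part y)
      \<and> singular_part (commutator x y) = - commutator x (singular_part y)"
  proof (cases "even n")
    case True
    then have 0: "singular_part z = 0" if "z \<in> offdiag" for z using singular_part_even that by blast
    have "s ^ (n - 2) = 1" using True by (simp add: s_power_even)
    then have "\<phi> (commutator x y) = commutator (\<phi> x) y + commutator x (\<phi> y)"
      using head_identity[OF x y] by simp
    then show ?thesis using x y by (simp add: regular_part_diag regular_part_def 0 commutator_simps
      singular_part_diag)
  next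
    case False
    then have odd: "odd (n - 2)" using n by auto
    define L where "L y = regular_part (commutator x y) - commutator (regular_part x) y - commutator
      x (regular_part y)" for y
    define L' where "L' y = singular_part (commutator x y) + commutator x (singular_part y)" for y
    have LL: "L y = L' y" if y: "y \<in> offdiag" for y
    proof -
      have "s * (regular_part (commutator x y) - singular_part (commutator x y))
        = s * (commutator (\<phi> x) y + commutator x (\<phi> y))"
        using head_identity[OF x y] x y by (simp add: s_power_odd[OF odd] phi_s)
      then have "regular_part (commutator x y) - singular_part (commutator x y)
        = commutator (regular_part x) y + commutator x (regular_part y + singular_part y)"
        unfolding s_cancel using x by (simp add: regular_part_diag phi_split[of y])
      then show ?thesis unfolding L_def L'_def by (simp add: commutator_simps algebra_simps)
    qed
    have "L (s * y) = s * L y" "L' (s * y) = - (s * L' y)"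
      using x y diag_maps[OF x]
      by (simp_all add: L_def L'_def commutator_s regular_part_s singular_part_s commutator_simps
        ring_distribs regular_part_diag)
    then have "s * L y = s * - L y" using LL[OF y] LL[of "s * y"] y by simp
    then have "L y = - L y" unfolding s_cancel .
    then have "L y = 0" by (rule eq_minus_imp_zero)
    then show ?thesis using LL[OF y] by (simp add: L_def L'_def algebra_simps eq_neg_iff_add_eq_0)
  qed
  then show "regular_part (commutator x y) = commutator (regular_part x) y
    + commutator x (regular_part y)"
    and "singular_part (commutator x y) = - commutator x (singular_part y)" by auto
qed

text \<open>
  As for \<open>parts_diag_offdiag\<close>, two defects \<open>T\<close> and \<open>T'\<close> coincide for odd \<open>n\<close>. Now both arguments are
  multiplied by \<open>s\<close>, which changes the sign of \<open>T\<close> and leaves \<open>T'\<close> unchanged.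
\<close>

lemma parts_offdiag_offdiag:
  assumes y: "y \<in> offdiag" and y': "y' \<in> offdiag"
  shows "regular_part (commutator y y') = commutator (regular_part y) y'
    + commutator y (regular_part y')"
    and "commutator (singular_part y) y' = commutator y (singular_part y')"
proof -
  have d: "regular_part (commutator y y') = \<phi> (commutator y y')" if "y \<in> offdiag" "y' \<in> offdiag"
    for y y'
    using that by (simp add: regular_part_diag)
  have "\<phi> (commutator y y') = commutator (regular_part y) y' + commutator y (regular_part y')
      \<and> commutator (singular_part y) y' = commutator y (singular_part y')"
  proof (cases "even n")
    case True
    then have 0: "singular_part z = 0" if "z \<in> offdiag" for z using singular_part_even that by blast
    have "s ^ (n - 2) = 1" using True by (simp add: s_power_even)
    then have "\<phi> (commutator y y') = commutator (\<phi> y) y' + commutator y (\<phi> y')"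
      using last_identity[OF y y'] by simp
    then show ?thesis using y y' by (simp add: regular_part_def 0 commutator_simps)
  next
    case False
    then have odd: "odd (n - 2)" using n by auto
    define T where "T y y' = \<phi> (commutator y y') - commutator (regular_part y) y' - commutator y
      (regular_part y')" for y y'
    define T' where "T' y y' = commutator y (singular_part y') - commutator (singular_part y) y'"
      for y y'
    have TT: "T y y' = T' y y'" if y: "y \<in> offdiag" "y' \<in> offdiag" for y y'
    proof -
      have "\<phi> (commutator (s * (s * y)) y') = commutator (s * \<phi> (s * y)) y'
        + commutator (s * (s * y)) (\<phi> y')"
        using last_identity[of "s * y" y'] y by (simp add: s_power_odd[OF odd])
      then have "\<phi> (commutator y y') = commutator (regular_part y - singular_part y) y'
        + commutator y (regular_part y' + singular_part y')"
        using phi_s[OF y(1)] phi_split[of y'] by simp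
      then show ?thesis by (simp add: T_def T'_def commutator_simps)
    qed
    have "T (s * y) (s * y') = - T y y'" "T' (s * y) (s * y') = T' y y'"
      using y y' by (simp_all add: T_def T'_def commutator_s regular_part_s singular_part_s
        commutator_simps lin
          regular_part_offdiag singular_part_offdiag(2))
    then have "T y y' = - T y y'" using TT[OF y y'] TT[of "s * y" "s * y'"] y y' by simp
    then have "T y y' = 0" by (rule eq_minus_imp_zero)
    then show ?thesis using TT[OF y y'] by (simp add: T_def T'_def algebra_simps)
  qed
  then show "regular_part (commutator y y') = commutator (regular_part y) y'
    + commutator y (regular_part y')"
    and "commutator (singular_part y) y' = commutator y (singular_part y')" using d[OF y y'] by auto
qed

lemma regular_part_diag_maps: "x \<in> diag \<Longrightarrow> regular_part x \<in> diag"
  by (simp add: regular_part_diag diag_maps)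

sublocale regular_part: graded_lie_map scale e f regular_part
  by (rule graded_lie_map.intro[OF peirce_axioms], rule graded_lie_map_axioms.intro)
    (fact regular_part_hom regular_part_diag_maps regular_part_offdiag regular_part_s
      parts_diag_offdiag(1) parts_offdiag_offdiag(1))+

sublocale singular_part: graded_singular_jordan scale e f singular_part
  by (rule graded_singular_jordan.intro[OF peirce_axioms], rule graded_singular_jordan_axioms.intro)
    (fact singular_part_hom singular_part_diag singular_part_offdiag(2) singular_part_s
      parts_diag_offdiag(2) parts_offdiag_offdiag(2))+

lemma singular_part_zero_if_even: "even n \<Longrightarrow> singular_part x = 0"
  by (rule grading_cases[of x]) (simp add: singular_part.lin singular_part_diag singular_part_even)

lemma singular_part_lie: "lie_leibniz singular_part n x = singular_part (lie_poly n x)"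
proof (cases "even n")
  case True
  then have "singular_part = (\<lambda>_. 0)" using singular_part_zero_if_even by auto
  then show ?thesis
    using lie_leibniz_derivation[of "\<lambda>_. 0"] by (simp add: commutator_simps)
next
  case False
  then obtain k where "n = Suc (2 * k)" by (auto elim!: oddE)
  then show ?thesis
    using lie_leibniz_triple_derivation[OF _ jordan_derivation_lie_triple[OF
      singular_part.is_jordan_derivation]] singular_part.lin(4)
    by blast
qed

text \<open>
  For \<open>n = 2\<close>, the map \<open>\<phi>\<close> is a Lie derivation, so the sum \<open>[\<phi> a, b] + [a, \<phi> b]\<close> vanishes exactly
  and not only modulo the centre. This replaces property (P).
\<close>

lemma correctable_of_centres:
  assumes "complementary g h" "centre (corner g) = sandwich g (centre UNIV) g"
    "centre (corner h) = sandwich h (centre UNIV) h"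
    and P: "n \<ge> 3 \<Longrightarrow> property_P (corner g) \<or> property_P (corner h)"
  shows "corner g \<subseteq> regular_part.correctable g" "corner h \<subseteq> regular_part.correctable h"
proof -
  have "corner g \<subseteq> regular_part.correctable g \<and> corner h \<subseteq> regular_part.correctable h"
  proof (cases "n \<ge> 3")
    case True
    then show ?thesis
      using P regular_part.correctable_of_property_P[OF assms(1-3)]
        regular_part.correctable_of_property_P[OF complementary_sym[OF assms(1)] assms(3,2)]
          by blast
  next
    case False
    then have n2: "n = Suc (Suc 0)" using n by simp
    have "commutator (regular_part a) b + commutator a (regular_part b) = 0" if "a \<in> corner g"
      "b \<in> corner h" for a b
    proof -
      have "commutator a b = 0" using corner_annihilate[OF assms(1) that]
        by (simp add: commutator_def)
      moreover have "\<phi> (commutator a b) = commutator (\<phi> a) b + commutator a (\<phi> b)"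
        using lie[of "(\<lambda>_. b)(Suc 0 := a)"] unfolding n2 by simp
      ultimately show ?thesis using that corner_diag by (simp add: regular_part_diag lin)
    qed
    then show ?thesis using regular_part.correctable_of_cross_zero[OF assms(1-3)] by blast
  qed
  then show "corner g \<subseteq> regular_part.correctable g" "corner h \<subseteq> regular_part.correctable h" by auto
qed

end

section \<open>The decomposition\<close>

lemma (in graded_lie_map) correctable_of_image:
  assumes "complementary g h" "sandwich h (\<psi> ` corner g) h \<subseteq> sandwich h (centre UNIV) h"
  shows "corner g \<subseteq> correctable g"
proof
  fix a assume a: "a \<in> corner g"
  then have d: "\<psi> a \<in> diag" using diag corner_diag by blast
  have "h * \<psi> a * h \<in> sandwich h (\<psi> ` corner g) h" using a unfolding sandwich_def by blast
  then have "h * \<psi> a * h \<in> sandwich h (centre UNIV) h" using assms(2) by blast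
  then obtain z where z: "z \<in> centre UNIV" "h * \<psi> a * h = h * z * h"
    by (auto simp: sandwich_def)
  then have "h * (\<psi> a - z) = 0"
    using d central_diag[OF z(1)] sandwich_central_diag[OF complementary_sym[OF assms(1)]]
    by (simp add: right_diff_distrib)
  then have "\<psi> a - z \<in> corner g"
    using corner_iff[OF assms(1)] d central_diag[OF z(1)] by simp
  then show "a \<in> correctable g" using a z(1) unfolding correctable_def by blast
qed

lemma (in peirce) commutator_hom: "module_hom scale scale (\<lambda>x. commutator x u)"
  by (simp add: module_hom_iff module_axioms commutator_simps)
    (simp add: commutator_def scale_mult_left[symmetric] scale_mult_right[symmetric]
      scale_right_diff_distrib)

lemma (in peirce) derivation_add_inner:
  assumes "derivation scale d"
  shows "derivation scale (\<lambda>x. d x + commutator x u)"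
proof -
  have d: "d (x + y) = d x + d y" "d (scale r x) = scale r (d x)" "d (x * y) = d x * y + x * d y"
    for x y r
    using assms unfolding derivation_def module_hom_iff by auto
  show ?thesis
    unfolding derivation_def module_hom_iff
    using module_hom.add[OF commutator_hom[of u]] module_hom.scale[OF commutator_hom[of u]]
      module_axioms
    by (auto simp: d scale_right_distrib) (simp add: commutator_def algebra_simps)
qed

lemma (in peirce) products_zero:
  assumes "{m * t | m t. m \<in> sandwich e UNIV f \<and> t \<in> sandwich f UNIV e} = {0}"
    and "{t * m | t m. t \<in> sandwich f UNIV e \<and> m \<in> sandwich e UNIV f} = {0}"
    and y: "y \<in> offdiag" "y' \<in> offdiag"
  shows "y * y' = 0"
proof -
  have s: "sandwich e UNIV f = {y \<in> offdiag. e * y = y}"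
    "sandwich f UNIV e = {y \<in> offdiag. f * y = y}"
    by (simp_all add: sandwich_offdiag)
  have "(e * y) * (f * y') \<in> {m * t | m t. m \<in> sandwich e UNIV f \<and> t \<in> sandwich f UNIV e}"
    unfolding s using y by force
  moreover have "(f * y) * (e * y') \<in> {t * m | t m. t \<in> sandwich f UNIV e \<and> m \<in> sandwich e UNIV f}"
    unfolding s using y by force
  ultimately have "(e * y) * (f * y') = 0" "(f * y) * (e * y') = 0"
    unfolding assms(1,2) by simp_all
  then have "e * (y * y') = 0" "f * (y * y') = 0" using y by (simp_all add: graded mult.assoc)
  then show ?thesis using e_plus_f_mult(1)[of "y * y'"] by simp
qed

theorem corollary2p15:
  fixes scale :: "'r::comm_ring_1 \<Rightarrow> 'a::ring_1 \<Rightarrow> 'a"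
    and e f :: 'a
    and n :: nat
    and \<phi> :: "'a \<Rightarrow> 'a"
  assumes n: "n \<ge> 2"
    and alg: "unital_algebra scale"
    and e: "e * e = e" "e \<noteq> 0" "e \<noteq> 1"
    and f: "f = 1 - e"
    and torsion_2: "\<forall>x::'a. of_nat 2 * x = 0 \<longrightarrow> x = 0"
    and torsion_n: "\<forall>x::'a. of_nat (n - 1) * x = 0 \<longrightarrow> x = 0"
    and faithful_e: "\<forall>x. {(e * x * e) * m | m. m \<in> sandwich e UNIV f} = {0} \<and>
                         {t * (e * x * e) | t. t \<in> sandwich f UNIV e} = {0} \<longrightarrow> e * x * e = 0"
    and faithful_f: "\<forall>x. {m * (f * x * f) | m. m \<in> sandwich e UNIV f} = {0} \<and>
                         {(f * x * f) * t | t. t \<in> sandwich f UNIV e} = {0} \<longrightarrow> f * x * f = 0"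
    and lie: "lie_n_derivation scale n \<phi>"
    and i:
      "(sandwich f (\<phi> ` sandwich e UNIV e) f \<subseteq> sandwich f (centre UNIV) f \<and>
        sandwich e (\<phi> ` sandwich f UNIV f) e \<subseteq> sandwich e (centre UNIV) e)
       \<or>
       (sandwich e UNIV e = idem_comm_subalgebra scale (sandwich e UNIV e) \<and>
        sandwich f UNIV f = idem_comm_subalgebra scale (sandwich f UNIV f))
       \<or>
       (sandwich e UNIV e = idem_comm_subalgebra scale (sandwich e UNIV e) \<and>
        centre (sandwich e UNIV e) = sandwich e (centre UNIV) e)
       \<or>
       (sandwich f UNIV f = idem_comm_subalgebra scale (sandwich f UNIV f) \<and>
        centre (sandwich f UNIV f) = sandwich f (centre UNIV) f)
       \<or>
       (centre (sandwich e UNIV e) = sandwich e (centre UNIV) e \<and>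
        centre (sandwich f UNIV f) = sandwich f (centre UNIV) f \<and>
        (n \<ge> 3 \<longrightarrow> property_P (sandwich e UNIV e) \<or> property_P (sandwich f UNIV f)))"
    and ii:
      "(\<forall>m\<in>sandwich e UNIV f. \<forall>t\<in>sandwich f UNIV e.
          e * \<phi> (t * m) * e + f * \<phi> (m * t) * f \<in> centre UNIV)
       \<or>
       ((\<forall>I. central_ideal scale I (sandwich e UNIV e) \<longrightarrow> I = {0}) \<or>
        (\<forall>I. central_ideal scale I (sandwich f UNIV f) \<longrightarrow> I = {0}))
       \<or>
       (\<exists>m0\<in>sandwich e UNIV f.
          centre UNIV = {a + b | a b. a \<in> sandwich e (centre UNIV) e \<and>
                                      b \<in> sandwich f (centre UNIV) f \<and> a * m0 = m0 * b})
       \<or>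
       (\<exists>t0\<in>sandwich f UNIV e.
          centre UNIV = {a + b | a b. a \<in> sandwich e (centre UNIV) e \<and>
                                      b \<in> sandwich f (centre UNIV) f \<and> t0 * a = b * t0})
       \<or>
       ({m * t | m t. m \<in> sandwich e UNIV f \<and> t \<in> sandwich f UNIV e} = {0} \<and>
        {t * m | t m. t \<in> sandwich f UNIV e \<and> m \<in> sandwich e UNIV f} = {0})"
  shows
    "(\<exists>d \<delta> \<gamma>.
        (\<forall>x. \<phi> x = d x + \<delta> x + \<gamma> x) \<and>
        derivation scale d \<and>
        singular_jordan_derivation scale e \<delta> \<and>
        central_map_vanishing scale n \<gamma> \<and>
        (((\<forall>I. central_ideal scale I (sandwich e UNIV e) \<longrightarrow> I = {0}) \<or>
          (\<forall>I. central_ideal scale I (sandwich f UNIV f) \<longrightarrow> I = {0})) \<or>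
         ({m * t | m t. m \<in> sandwich e UNIV f \<and> t \<in> sandwich f UNIV e} = {0} \<and>
          {t * m | t m. t \<in> sandwich f UNIV e \<and> m \<in> sandwich e UNIV f} = {0})
         \<longrightarrow> antiderivation scale \<delta>))
     \<and>
     (even n \<or>
      (sandwich f (\<phi> ` sandwich e UNIV f) e = {0} \<and> sandwich e (\<phi> ` sandwich f UNIV e) f = {0})
      \<longrightarrow> standard_lie_n_derivation scale n \<phi>)"
proof -
  have P: "peirce scale e f"
  proof (rule peirce.intro[OF alg], rule peirce_axioms.intro)
    show "x = 0" if "x + x = 0" for x :: 'a
    proof -
      have "of_nat 2 * x = x + x" by (simp add: mult_2)
      then show ?thesis using torsion_2[rule_format, of x] that by metis
    qed
  next
    fix w assume c: "e * w = w * e" and ann: "\<And>y. e * y = y * f \<Longrightarrow> w * y = 0 \<and> y * w = 0"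
    have idf: "f * f = f" "e * f = 0" "f * e = 0" using e(1) by (simp_all add: f algebra_simps)
    have cf: "f * w = w * f" using c by (simp add: f algebra_simps)
    have M: "w * m = 0 \<and> m * w = 0 \<and> e * m = m \<and> m * f = m" if m: "m \<in> sandwich e UNIV f" for m
    proof -
      obtain x where x: "m = e * x * f" using m by (auto simp: sandwich_def)
      have "e * m = m" "m * f = m" using e(1) idf
        by (simp_all add: x mult.assoc) (simp flip: mult.assoc add: e(1))
      then show ?thesis using ann[of m] by simp
    qed
    have T: "w * t = 0 \<and> t * w = 0 \<and> f * t = t \<and> t * e = t" if t: "t \<in> sandwich f UNIV e" for t
    proof -
      obtain x where x: "t = f * x * e" using t by (auto simp: sandwich_def)
      have 1: "f * t = t" "t * e = t" using e(1) idf
        by (simp_all add: x mult.assoc) (simp flip: mult.assoc add: idf)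
      have "e * t = e * (f * t)" "t * f = t * e * f" using 1 by simp_all
      then have "e * t = t * f" using idf
        by (simp add: mult.assoc[symmetric]) (simp add: mult.assoc idf)
      then show ?thesis using ann[of t] 1 by simp
    qed
    have in0: "0 \<in> sandwich e UNIV f" "0 \<in> sandwich f UNIV e"
      unfolding sandwich_def by (auto intro!: exI[of _ 0])
    have ew: "e * w * e = w * e" using c e(1) by (simp add: mult.assoc)
    have fw: "f * w * f = w * f" using cf idf(1) by (simp add: mult.assoc)
    have "e * w * e * m = 0" if "m \<in> sandwich e UNIV f" for m
      using M[OF that] by (simp add: ew mult.assoc)
    moreover have "t * (e * w * e) = 0" if "t \<in> sandwich f UNIV e" for t
      using T[OF that] by (simp add: ew mult.assoc[symmetric])
    ultimately have "{(e * w * e) * m | m. m \<in> sandwich e UNIV f} = {0}"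
        "{t * (e * w * e) | t. t \<in> sandwich f UNIV e} = {0}"
      using in0 by force+
    then have 1: "w * e = 0" using faithful_e[THEN spec, THEN mp, OF conjI] unfolding ew[symmetric]
      by blast
    have "m * (f * w * f) = 0" if "m \<in> sandwich e UNIV f" for m
      using M[OF that] by (simp add: fw mult.assoc[symmetric])
    moreover have "f * w * f * t = 0" if "t \<in> sandwich f UNIV e" for t
      using T[OF that] by (simp add: fw mult.assoc)
    ultimately have "{m * (f * w * f) | m. m \<in> sandwich e UNIV f} = {0}"
        "{(f * w * f) * t | t. t \<in> sandwich f UNIV e} = {0}"
      using in0 by force+
    then have 2: "w * f = 0" using faithful_f[THEN spec, THEN mp, OF conjI] unfolding fw[symmetric]
      by blast
    show "w = 0" using 1 2 by (simp add: f algebra_simps)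
  qed (use e f in auto)
  interpret peirce scale e f by (rule P)
  \<comment> \<open>chosen so that \<open>[e, u]\<close> is the odd part of \<open>\<phi> e\<close>\<close>
  define u where "u = - (s * odd_part (\<phi> e))"
  define \<phi>' where "\<phi>' x = \<phi> x - commutator x u" for x
  have u: "u \<in> offdiag" by (simp add: u_def)
  have \<phi>_hom: "module_hom scale scale \<phi>" and \<phi>_lie: "\<phi> (lie_poly n x) = lie_leibniz \<phi> n x" for x
    using lie unfolding lie_n_derivation_iff by auto
  have inner_lie: "lie_leibniz (\<lambda>x. commutator x u) k x = commutator (lie_poly k x) u" for k x
    by (rule lie_leibniz_derivation) (simp_all add: commutator_def algebra_simps)
  interpret N: normalized_lie scale e f n \<phi>'
  proof (rule normalized_lie.intro[OF P], rule normalized_lie_axioms.intro)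
    show "n \<ge> 2" by (rule n)
    show "module_hom scale scale \<phi>'"
      using module_hom.add[OF \<phi>_hom] module_hom.scale[OF \<phi>_hom]
        module_hom.add[OF commutator_hom[of u]] module_hom.scale[OF commutator_hom[of u]]
      by (simp add: module_hom_iff module_axioms \<phi>'_def scale_right_diff_distrib)
    show "\<phi>' (lie_poly n x) = lie_leibniz \<phi>' n x" for x
      unfolding \<phi>'_def[abs_def] lie_leibniz_diff inner_lie \<phi>_lie ..
    show "v = 0" if "of_nat (n - 1) * v = 0" for v :: 'a using torsion_n that by blast
    have "commutator e u = odd_part (\<phi> e)"
    proof -
      have "commutator e u = - commutator u e" by (simp add: commutator_def)
      also have "\<dots> = odd_part (\<phi> e)" using u by (simp add: commutator_offdiag_e) (simp add: u_def)
      finally show ?thesis .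
    qed
    then have "\<phi>' e = even_part (\<phi> e)" using even_odd[of "\<phi> e"] by (simp add: \<phi>'_def algebra_simps)
    then show "\<phi>' e \<in> diag" by simp
  qed
  \<comment> \<open>the inner derivation is odd, so it does not affect the blocks of \<open>\<phi>\<close> named in the hypotheses\<close>
  have same_diag: "h * N.regular_part x * h = h * \<phi> x * h" if "x \<in> diag" "complementary g h"
    for x g h
  proof -
    have "h * commutator x u * h = h * (g * commutator x u)"
      using that u complementary_simps(17)[OF that(2)] by (simp add: mult.assoc)
    then show ?thesis
      using that(1) complementary_simps(8)[OF that(2)]
        by (simp add: N.regular_part_diag \<phi>'_def ring_distribs)
  qed
  have same_off: "h * \<phi>' y * g = h * \<phi> y * g" if "y \<in> offdiag" "complementary g h" for y g h
  proof -
    have "h * commutator y u * g = h * (g * commutator y u)"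
      using that u complementary_simps(11)[OF that(2)] by (simp add: mult.assoc)
    then show ?thesis
      using complementary_simps(8)[OF that(2)] by (simp add: \<phi>'_def ring_distribs)
  qed
  note sw = sandwich_corner[OF complementary_ef(1)] sandwich_corner[OF complementary_ef(2)]
  have im: "sandwich h (N.regular_part ` corner g) h = sandwich h (\<phi> ` corner g) h"
    if "complementary g h" for g h
  proof -
    have "sandwich h (F ` corner g) h = (\<lambda>a. h * F a * h) ` corner g" for F
      by (auto simp: sandwich_def)
    moreover have "(\<lambda>a. h * N.regular_part a * h) ` corner g = (\<lambda>a. h * \<phi> a * h) ` corner g"
      by (rule image_cong[OF refl same_diag[OF corner_diag that]])
    ultimately show ?thesis by simp
  qed
  have correctable: "corner e \<subseteq> N.regular_part.correctable e
    \<and> corner f \<subseteq> N.regular_part.correctable f"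
    using i unfolding sw
  proof (elim disjE conjE)
    assume "sandwich f (\<phi> ` corner e) f \<subseteq> sandwich f (centre UNIV) f"
      "sandwich e (\<phi> ` corner f) e \<subseteq> sandwich e (centre UNIV) e"
    then show ?thesis
      using N.regular_part.correctable_of_image[OF complementary_ef(1)]
        N.regular_part.correctable_of_image[OF complementary_ef(2)]
      unfolding im[OF complementary_ef(1)] im[OF complementary_ef(2)] by blast
  next
    assume "corner e = idem_comm_subalgebra scale (corner e)"
      "corner f = idem_comm_subalgebra scale (corner f)"
    then show ?thesis
      using N.regular_part.correctable_idem_comm_subalgebra[OF complementary_ef(1)]
        N.regular_part.correctable_idem_comm_subalgebra[OF complementary_ef(2)] by blast
  next
    assume "corner e = idem_comm_subalgebra scale (corner e)"
      "centre (corner e) = sandwich e (centre UNIV) e"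
    then show ?thesis
      using N.regular_part.correctable_idem_comm_subalgebra[OF complementary_ef(1)]
        N.regular_part.correctable_complementary[OF complementary_ef(1)] by blast
  next
    assume "corner f = idem_comm_subalgebra scale (corner f)"
      "centre (corner f) = sandwich f (centre UNIV) f"
    then show ?thesis
      using N.regular_part.correctable_idem_comm_subalgebra[OF complementary_ef(2)]
        N.regular_part.correctable_complementary[OF complementary_ef(2)] by blast
  next
    assume "centre (corner e) = sandwich e (centre UNIV) e"
      "centre (corner f) = sandwich f (centre UNIV) f"
      "n \<ge> 3 \<longrightarrow> property_P (corner e) \<or> property_P (corner f)"
    then show ?thesis using N.correctable_of_centres[OF complementary_ef(1)] by blast
  qed
  interpret Q: proper_graded_lie_map scale e f N.regular_part
    by (rule proper_graded_lie_map.intro[OF N.regular_part.graded_lie_map_axioms], rule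
      proper_graded_lie_map_axioms.intro)
      (use correctable in auto)
  note so = sandwich_offdiag[of e f, simplified] sandwich_offdiag[of f e, simplified]
  have w0: "Q.leibniz_defect y y' = 0" if y: "y \<in> offdiag" "y' \<in> offdiag" for y y'
    using ii unfolding sw
  proof (elim disjE bexE conjE)
    assume *: "\<forall>m\<in>sandwich e UNIV f. \<forall>t\<in>sandwich f UNIV e.
          e * \<phi> (t * m) * e + f * \<phi> (m * t) * f \<in> centre UNIV"
    show ?thesis
    proof (rule Q.leibniz_defect_vanishes_central_values[OF _ y])
      fix m t assume m: "m \<in> offdiag" "t \<in> offdiag" "e * m = m" "f * t = t"
      then show "e * N.regular_part (t * m) * e + f * N.regular_part (m * t) * f \<in> centre UNIV"
        using * same_diag[OF _ complementary_ef(2), of "t * m"]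
          same_diag[OF _ complementary_ef(1), of "m * t"]
        by (simp add: so)
    qed
  next
    assume "\<forall>I. central_ideal scale I (corner e) \<longrightarrow> I = {0}"
    then show ?thesis using Q.leibniz_defect_vanishes_no_central_ideal[OF complementary_ef(1) _ y]
      by blast
  next
    assume "\<forall>I. central_ideal scale I (corner f) \<longrightarrow> I = {0}"
    then show ?thesis using Q.leibniz_defect_vanishes_no_central_ideal[OF complementary_ef(2) _ y]
      by blast
  next
    fix m0 assume m0: "m0 \<in> sandwich e UNIV f" and Z: "centre UNIV =
      {a + b | a b. a \<in> sandwich e (centre UNIV) e \<and> b \<in> sandwich f (centre UNIV) f \<and> a * m0 = m0 *
        b}"
    show ?thesis
    proof (rule Q.leibniz_defect_vanishes_detecting_element[OF complementary_ef(1) _ _ _ y])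
      fix a b assume "a \<in> sandwich e (centre UNIV) e" "b \<in> sandwich f (centre UNIV) f"
        "a * m0 = m0 * b"
      then show "a + b \<in> centre UNIV" by (subst Z) blast
    qed (use m0 so in auto)
  next
    fix t0 assume t0: "t0 \<in> sandwich f UNIV e" and Z: "centre UNIV =
      {a + b | a b. a \<in> sandwich e (centre UNIV) e \<and> b \<in> sandwich f (centre UNIV) f \<and> t0 * a = b *
        t0}"
    show ?thesis
    proof (rule Q.leibniz_defect_vanishes_detecting_element[OF complementary_ef(2) _ _ _ y])
      fix b a assume "b \<in> sandwich f (centre UNIV) f" "a \<in> sandwich e (centre UNIV) e"
        "b * t0 = t0 * a"
      then have "a + b \<in> centre UNIV" by (subst Z) force
      then show "b + a \<in> centre UNIV" by (simp add: add.commute)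
    qed (use t0 so in auto)
  next
    assume "{m * t | m t. m \<in> sandwich e UNIV f \<and> t \<in> sandwich f UNIV e} = {0}"
      "{t * m | t m. t \<in> sandwich f UNIV e \<and> m \<in> sandwich e UNIV f} = {0}"
    then show ?thesis using Q.leibniz_defect_vanishes_products[OF products_zero y] by blast
  qed
  define d where "d x = Q.der x + commutator x u" for x
  have d: "derivation scale d"
    unfolding d_def by (rule derivation_add_inner[OF Q.der_derivation[OF w0]])
  have decomp: "\<phi> x = d x + N.singular_part x + Q.gamma x" for x
    using N.phi_split[of x] by (simp add: d_def Q.der_def \<phi>'_def algebra_simps)
  have d_lie: "lie_leibniz d n x = d (lie_poly n x)" for x
  proof (rule lie_leibniz_derivation)
    have d': "module_hom scale scale d" "d (x * y) = d x * y + x * d y" for x y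
      using d by (simp_all add: derivation_def)
    show "d 0 = 0" using d'(1) module_hom.zero by blast
    show "d (commutator x y) = commutator (d x) y + commutator x (d y)" for x y
      by (simp add: commutator_def module_hom.diff[OF d'(1)] d'(2))
  qed
  have gamma: "central_map_vanishing scale n Q.gamma"
    unfolding central_map_vanishing_def
  proof (intro conjI allI Q.gamma_hom)
    show "range Q.gamma \<subseteq> centre UNIV" using Q.gamma_central by auto
    then have "lie_leibniz Q.gamma n x = 0" for x using n by (rule lie_leibniz_central)
    moreover have g: "Q.gamma = (\<lambda>x. (\<phi> x - d x) - N.singular_part x)"
      using decomp by (simp add: fun_eq_iff)
    ultimately have "lie_leibniz (\<lambda>x. (\<phi> x - d x) - N.singular_part x) n x = 0" for x
      by simp
    then show "Q.gamma (lie_poly n x) = 0" for x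
      unfolding g lie_leibniz_diff d_lie N.singular_part_lie \<phi>_lie .
  qed
  have anti: "antiderivation scale N.singular_part"
    if "((\<forall>I. central_ideal scale I (corner e) \<longrightarrow> I = {0}) \<or>
          (\<forall>I. central_ideal scale I (corner f) \<longrightarrow> I = {0})) \<or>
         ({m * t | m t. m \<in> sandwich e UNIV f \<and> t \<in> sandwich f UNIV e} = {0} \<and>
          {t * m | t m. t \<in> sandwich f UNIV e \<and> m \<in> sandwich e UNIV f} = {0})"
    using that
  proof (elim disjE conjE)
    assume "\<forall>I. central_ideal scale I (corner e) \<longrightarrow> I = {0}"
    then show ?thesis using N.singular_part.antiderivation_no_central_ideal[OF complementary_ef(1)]
      by blast
  next
    assume "\<forall>I. central_ideal scale I (corner f) \<longrightarrow> I = {0}"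
    then show ?thesis using N.singular_part.antiderivation_no_central_ideal[OF complementary_ef(2)]
      by blast
  next
    assume "{m * t | m t. m \<in> sandwich e UNIV f \<and> t \<in> sandwich f UNIV e} = {0}"
      "{t * m | t m. t \<in> sandwich f UNIV e \<and> m \<in> sandwich e UNIV f} = {0}"
    note z = products_zero[OF this]
    show ?thesis
      by (rule N.singular_part.antiderivationI) (rule z; simp add: N.singular_part_offdiag(2))+
  qed
  have std: "standard_lie_n_derivation scale n \<phi>"
    if "even n \<or> (sandwich f (\<phi> ` sandwich e UNIV f) e = {0} \<and> sandwich e (\<phi> ` sandwich f UNIV e) f
      = {0})"
  proof -
    have "N.singular_part x = 0" for x
      using that
    proof (elim disjE conjE)
      assume "even n"
      then show ?thesis by (rule N.singular_part_zero_if_even)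
    next
      assume 0: "sandwich f (\<phi> ` sandwich e UNIV f) e = {0}"
        "sandwich e (\<phi> ` sandwich f UNIV e) f = {0}"
      have "f * \<phi> (e * x * f) * e \<in> sandwich f (\<phi> ` sandwich e UNIV f) e"
        "e * \<phi> (f * x * e) * f \<in> sandwich e (\<phi> ` sandwich f UNIV e) f"
        unfolding sandwich_def by blast+
      moreover have "e * x * f \<in> offdiag" "f * x * e \<in> offdiag"
        by (simp_all add: offdiag_iff mult.assoc)
      ultimately show ?thesis
        using same_off[OF _ complementary_ef(1)] same_off[OF _ complementary_ef(2)]
          by (simp add: N.singular_part_def 0)
    qed
    then show ?thesis
      unfolding standard_lie_n_derivation_def using lie d gamma decomp by auto
  qed
  show ?thesis
    using decomp d N.singular_part.singular gamma anti std unfolding sw by blast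
qed

end
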